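(* Let $g_1,\dots,g_m:\mathbb{R}^n\to\mathbb{R}$ be differentiable functions that are definable in the same o-minimal structure on $(\mathbb{R},+,\cdot)$. Then, for all except finitely many $\alpha\in\mathbb{R}$, the Mangasarian-Fromovitz constraint qualification holds at every point of $$C_\alpha=\{x\in\mathbb{R}^n \mid g_1(x)\le\alpha,\dots,g_m(x)\le\alpha\}.$$ The same conclusion (for all except finitely many $\alpha\in\mathbb{R}$, the Mangasarian-Fromovitz constraint qualification holds at every point) holds for the sets $$\{x\in\mathbb{R}^n \mid g_1(x)\le 0,\dots,g_p(x)\le 0,\ g_{p+1}(x)\le\alpha,\dots,g_m(x)\le\alpha\}$$ if the Mangasarian-Fromovitz constraint qualification holds at every point of $\{x\in\mathbb{R}^n \mid g_1(x)\le 0,\dots,g_p(x)\le 0\}$ for some $p<m$.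
   Context: An o-minimal structure on $(\mathbb{R},+,\cdot)$ is a sequence $(\mathcal{O}_p)_{p\in\mathbb{N}}$ where each $\mathcal{O}_p$ is a Boolean algebra of subsets of $\mathbb{R}^p$ such that: if $A\in\mathcal{O}_p$ then $A\times\mathbb{R},\ \mathbb{R}\times A\in\mathcal{O}_{p+1}$; if $A\in\mathcal{O}_{p+1}$ then its projection on the first $p$ coordinates is in $\mathcal{O}_p$; $\mathcal{O}_p$ contains all zero sets of real polynomials on $\mathbb{R}^p$; and the elements of $\mathcal{O}_1$ are exactly the finite unions of points and intervals. A set is definable if it belongs to the structure; a function is definable if its graph is. For a set of the form $\{x \mid g_i(x)\le\mu_i,\ i\in S\}$ with $S$ a finite index set and $\mu_i\in\mathbb{R}$, a point $x$ of the set satisfies the Mangasarian-Fromovitz constraint qualification if there exists $y\in\mathbb{R}^n$ with $\langle y,\nabla g_i(x)\rangle<0$ for every $i\in S$ with $g_i(x)=\mu_i$ (vacuous if there is no such $i$). If the set is empty, the condition holds vacuously throughout it. *)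

theory Defs
  imports "HOL-Analysis.Analysis"
begin

section \<open>O-minimal structures on the real field\<close>

text \<open>The dimension varies inside an o-minimal structure, so points of
  \<open>\<real>\<^sup>p\<close> are represented here by lists of reals of length \<open>p\<close>.\<close>

definition Rpow :: "nat \<Rightarrow> real list set" where
  "Rpow p = {xs. length xs = p}"

inductive polynomial_fun :: "nat \<Rightarrow> (real list \<Rightarrow> real) \<Rightarrow> bool" for p :: nat where
  const: "polynomial_fun p (\<lambda>xs. c)"
| coord: "i < p \<Longrightarrow> polynomial_fun p (\<lambda>xs. xs ! i)"
| add: "polynomial_fun p f \<Longrightarrow> polynomial_fun p h \<Longrightarrow> polynomial_fun p (\<lambda>xs. f xs + h xs)"
| mult: "polynomial_fun p f \<Longrightarrow> polynomial_fun p h \<Longrightarrow> polynomial_fun p (\<lambda>xs. f xs * h xs)"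

text \<open>In \<open>dim_one\<close>, points are covered as degenerate intervals \<open>{a}\<close>; intervals may be
  open, closed or half-open, bounded or unbounded.\<close>

locale o_minimal_structure =
  fixes \<O> :: "nat \<Rightarrow> real list set set"
  assumes boolean_algebra: "algebra (Rpow p) (\<O> p)"
    and times_real: "A \<in> \<O> p \<Longrightarrow> {xs @ [t] | xs t. xs \<in> A} \<in> \<O> (Suc p)"
    and real_times: "A \<in> \<O> p \<Longrightarrow> {t # xs | t xs. xs \<in> A} \<in> \<O> (Suc p)"
    and projection: "A \<in> \<O> (Suc p) \<Longrightarrow> take p ` A \<in> \<O> p"
    and zero_set: "polynomial_fun p f \<Longrightarrow> {xs \<in> Rpow p. f xs = 0} \<in> \<O> p"
    and dim_one: "A \<in> \<O> 1 \<longleftrightarrow>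
      (\<exists>F. finite F \<and> (\<forall>I\<in>F. is_interval I) \<and> A = {[t] | t::real. t \<in> \<Union>F})"

text \<open>The linear order on the index type only serves to list the coordinates of a vector;
  every finite type can be linearly ordered.\<close>

definition coords :: "real ^ 'n::{finite,linorder} \<Rightarrow> real list" where
  "coords x = map (\<lambda>i. x $ i) (sorted_list_of_set UNIV)"

definition definable_fun ::
    "(nat \<Rightarrow> real list set set) \<Rightarrow> (real ^ 'n::{finite,linorder} \<Rightarrow> real) \<Rightarrow> bool" where
  "definable_fun \<O> f \<longleftrightarrow> {coords x @ [f x] | x. True} \<in> \<O> (CARD('n) + 1)"

section \<open>The Mangasarian-Fromovitz constraint qualification\<close>

definition gradient :: "('a::real_inner \<Rightarrow> real) \<Rightarrow> 'a \<Rightarrow> 'a" where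
  "gradient f x = (THE D. GDERIV f x :> D)"

lemma gradient_eqI:
  assumes "GDERIV f x :> D"
  shows "gradient f x = D"
  unfolding gradient_def
proof (rule the_equality)
  show "GDERIV f x :> D" by (fact assms)
next
  fix E assume "GDERIV f x :> E"
  then have "(\<lambda>h. inner h E) = (\<lambda>h. inner h D)"
    using assms unfolding gderiv_def by (rule has_derivative_unique)
  then show "E = D"
    by (metis inner_commute vector_eq_rdot)
qed

lemma gderiv_gradient:
  fixes f :: "'a::euclidean_space \<Rightarrow> real"
  assumes "f differentiable (at x)"
  shows "GDERIV f x :> gradient f x"
proof -
  obtain f' where f': "(f has_derivative f') (at x)"
    using assms unfolding differentiable_def by blast
  then have "linear f'"
    by (rule has_derivative_linear)
  then have "f' = (\<lambda>h. inner h (adjoint f' 1))"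
    by (auto simp: adjoint_works fun_eq_iff)
  with f' have "GDERIV f x :> adjoint f' 1"
    unfolding gderiv_def by simp
  then show ?thesis
    using gradient_eqI by metis
qed

definition sublevel_set :: "'i set \<Rightarrow> ('i \<Rightarrow> 'a \<Rightarrow> real) \<Rightarrow> ('i \<Rightarrow> real) \<Rightarrow> 'a set" where
  "sublevel_set S g \<mu> = {x. \<forall>i\<in>S. g i x \<le> \<mu> i}"

definition MFCQ_at ::
    "'i set \<Rightarrow> ('i \<Rightarrow> 'a::real_inner \<Rightarrow> real) \<Rightarrow> ('i \<Rightarrow> real) \<Rightarrow> 'a \<Rightarrow> bool" where
  "MFCQ_at S g \<mu> x \<longleftrightarrow>
     (\<exists>y. \<forall>i\<in>S. g i x = \<mu> i \<longrightarrow> inner y (gradient (g i) x) < 0)"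

definition MFCQ ::
    "'i set \<Rightarrow> ('i \<Rightarrow> 'a::real_inner \<Rightarrow> real) \<Rightarrow> ('i \<Rightarrow> real) \<Rightarrow> bool" where
  "MFCQ S g \<mu> \<longleftrightarrow> (\<forall>x\<in>sublevel_set S g \<mu>. MFCQ_at S g \<mu> x)"

end

theory Submission
  imports Defs
begin

text \<open>Write \<open>\<mu>\<^sub>i(\<alpha>)\<close> for the level of the \<open>i\<close>-th constraint: it is \<open>0\<close> for the constraints that
  are kept fixed and \<open>\<alpha>\<close> for the others. Suppose that infinitely many levels \<open>\<alpha>\<close> are bad, that is,
  admit a feasible point at which the qualification fails. There are finitely many possible active
  sets, so a single active set \<open>I\<close> occurs for infinitely many \<open>\<alpha>\<close>. The pairs \<open>(\<alpha>, x)\<close> such that \<open>x\<close>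
  is bad at level \<open>\<alpha>\<close> with active set \<open>I\<close> form a definable set. Gradients are kept out of its
  definition by \<open>strict_descent_iff\<close>: the qualification at \<open>x\<close> means that for some \<open>y\<close>, all
  \<open>g\<^sub>i(x + s y) \<le> g\<^sub>i(x) - s\<close>, \<open>i \<in> I\<close>, hold for every small \<open>s > 0\<close>. By o-minimality some interval
  consists of bad levels.

  Over a smaller interval there is a curve \<open>x(\<alpha>)\<close> of bad points all of whose coordinates are
  monotone (\<open>definable_monotone_curve\<close>). A signed sum \<open>h\<close> of the coordinates is then increasing and
  dominates the variation of the curve. The slopes of a real function cannot be large near every
  point of a compact interval, so at some \<open>t\<close> there are \<open>s\<^sub>k \<rightarrow> t\<close>, \<open>s\<^sub>k \<noteq> t\<close>, along which the slopes of
  \<open>h\<close>, hence the difference quotients of \<open>x\<close>, stay bounded. After passing to a subsequence these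
  quotients converge to a vector \<open>v\<close> (\<open>monotone_curve_difference_quotient\<close>).

  Along the curve \<open>g\<^sub>i(x(\<alpha>)) = \<mu>\<^sub>i(\<alpha>)\<close> for \<open>i \<in> I\<close>. Differentiating in the direction \<open>v\<close> gives
  \<open>\<langle>v, \<nabla>g\<^sub>i\<rangle> = 0\<close> for the fixed and \<open>\<langle>v, \<nabla>g\<^sub>i\<rangle> = 1\<close> for the moving constraints in \<open>I\<close>, at the point
  \<open>x(t)\<close>. If \<open>y\<close> is a descent direction there for the active fixed constraints, then \<open>y - N v\<close> with \<open>N\<close>
  large is one for all of \<open>I\<close>, although the qualification fails at \<open>x(t)\<close>.

  The o-minimal input is elementary because the field is \<open>\<real>\<close>. An interval covered, up to countably
  many points, by countably many definable sets meets one of them in an infinite set, and an infinite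
  definable subset of the line contains an interval (\<open>countable_definable_cover\<close>). Both the choice
  of definable selections and the monotonicity of definable functions on a subinterval follow from
  this.\<close>

section \<open>Definable predicates\<close>

text \<open>Formulas are represented by predicates on assignments \<open>e :: nat \<Rightarrow> real\<close> of the variables, with
  the variables below \<open>N\<close> standing for the coordinates of \<open>\<real>\<^sup>N\<close>. Assignments are total, so the
  number of variables need not be fixed in advance, and bound variables are handled as de Bruijn
  indices.\<close>

definition depends_below :: "nat \<Rightarrow> ((nat \<Rightarrow> real) \<Rightarrow> 'b) \<Rightarrow> bool" where
  "depends_below N P \<longleftrightarrow> (\<forall>e e'. (\<forall>i<N. e i = e' i) \<longrightarrow> P e = P e')"

definition tuples :: "nat \<Rightarrow> ((nat \<Rightarrow> real) \<Rightarrow> bool) \<Rightarrow> real list set" where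
  "tuples N P = {map e [0..<N] | e. P e}"

lemma depends_belowD: "depends_below N P \<Longrightarrow> (\<And>i. i < N \<Longrightarrow> e i = e' i) \<Longrightarrow> P e = P e'"
  unfolding depends_below_def by blast

lemma depends_below_mono: "depends_below N P \<Longrightarrow> N \<le> M \<Longrightarrow> depends_below M P"
  unfolding depends_below_def by (meson order_less_le_trans)

lemma tuples_iff: "depends_below N P \<Longrightarrow> map e [0..<N] \<in> tuples N P \<longleftrightarrow> P e"
  unfolding tuples_def depends_below_def by auto (metis atLeast0LessThan lessThan_iff)

lemma map_nth_env: "length xs = N \<Longrightarrow> map (\<lambda>i. xs ! i) [0..<N] = xs"
  by (auto simp: list_eq_iff_nth_eq)

lemma tuples_eq:
  "depends_below N P \<Longrightarrow> tuples N P = {xs \<in> Rpow N. P (\<lambda>i. xs ! i)}"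
proof -
  assume P: "depends_below N P"
  have "xs \<in> tuples N P \<longleftrightarrow> P (\<lambda>i. xs ! i)" if "length xs = N" for xs
    using tuples_iff[OF P, of "\<lambda>i. xs ! i"] map_nth_env[OF that] by simp
  moreover have "tuples N P \<subseteq> Rpow N"
    by (auto simp: tuples_def Rpow_def)
  ultimately show ?thesis
    by (auto simp: Rpow_def)
qed

lemma take_tuples: "take N ` tuples (Suc N) P = tuples N P"
proof -
  have "take N (map e [0..<Suc N]) = map e [0..<N]" for e :: "nat \<Rightarrow> real"
    by simp
  then have "take N ` {map e [0..<Suc N] | e. P e} = {map e [0..<N] | e. P e}"
    by (auto simp: image_def simp del: upt_Suc)
  then show ?thesis
    unfolding tuples_def .
qed

lemma tuples_Suc:
  assumes "depends_below N P"
  shows "tuples (Suc N) P = {xs @ [t] | xs t. xs \<in> tuples N P}"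
proof (intro set_eqI iffI)
  fix zs assume "zs \<in> tuples (Suc N) P"
  then show "zs \<in> {xs @ [t] | xs t. xs \<in> tuples N P}"
    by (auto simp: tuples_def)
next
  fix zs assume "zs \<in> {xs @ [t] | xs t. xs \<in> tuples N P}"
  then obtain e t where e: "P e" "zs = map e [0..<N] @ [t]"
    by (auto simp: tuples_def)
  then have "zs = map (e(N := t)) [0..<Suc N]"
    by simp
  moreover have "P (e(N := t))"
    using e(1) depends_belowD[OF assms, of e "e(N := t)"] by simp
  ultimately show "zs \<in> tuples (Suc N) P"
    unfolding tuples_def by blast
qed

lemma tuples_shift:
  "tuples (Suc N) (\<lambda>e. P (\<lambda>i. e (Suc i))) = {t # xs | t xs. xs \<in> tuples N P}"
proof (intro set_eqI iffI)
  fix zs assume "zs \<in> tuples (Suc N) (\<lambda>e. P (\<lambda>i. e (Suc i)))"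
  then obtain e where e: "P (\<lambda>i. e (Suc i))" "zs = map e [0..<Suc N]"
    by (auto simp: tuples_def)
  moreover have "map e [0..<Suc N] = e 0 # map (\<lambda>i. e (Suc i)) [0..<N]"
    by (simp add: upt_conv_Cons map_Suc_upt[symmetric] del: upt_Suc)
  ultimately have "zs = e 0 # map (\<lambda>i. e (Suc i)) [0..<N]"
      "map (\<lambda>i. e (Suc i)) [0..<N] \<in> tuples N P"
    by (auto simp: tuples_def)
  then show "zs \<in> {t # xs | t xs. xs \<in> tuples N P}"
    by blast
next
  fix zs assume "zs \<in> {t # xs | t xs. xs \<in> tuples N P}"
  then obtain e t where e: "P e" "zs = t # map e [0..<N]"
    by (auto simp: tuples_def)
  have "map (case_nat t e) [0..<Suc N] = t # map e [0..<N]"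
    by (simp add: upt_conv_Cons map_Suc_upt[symmetric] del: upt_Suc)
  then show "zs \<in> tuples (Suc N) (\<lambda>e. P (\<lambda>i. e (Suc i)))"
    unfolding tuples_def using e by (intro CollectI exI[of _ "case_nat t e"]) simp
qed

context o_minimal_structure
begin

definition definable :: "((nat \<Rightarrow> real) \<Rightarrow> bool) \<Rightarrow> bool" where
  "definable P \<longleftrightarrow> (\<exists>N. depends_below N P \<and> tuples N P \<in> \<O> N)"

lemma definableI: "depends_below N P \<Longrightarrow> tuples N P \<in> \<O> N \<Longrightarrow> definable P"
  unfolding definable_def by blast

lemma definableE:
  assumes "definable P" obtains N where "depends_below N P"
  using assms unfolding definable_def by blast

text \<open>Adding a dummy variable takes the product with \<open>\<real>\<close>, removing one projects it away. Hence
  membership in the structure can be tested at any \<open>N\<close> below which the predicate depends on its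
  variables, and two predicates can always be compared at a common \<open>N\<close>.\<close>

lemma tuples_in_structure:
  assumes "definable P" "depends_below N P"
  shows "tuples N P \<in> \<O> N"
proof -
  obtain M where M: "depends_below M P" "tuples M P \<in> \<O> M"
    using assms(1) unfolding definable_def by blast
  show ?thesis
  proof (cases "M \<le> N")
    case True
    then show ?thesis
    proof (induction N rule: dec_induct)
      case base
      show ?case by (rule M)
    next
      case (step n)
      then show ?case
        using times_real[OF step.IH] tuples_Suc[OF depends_below_mono[OF M(1)]] by simp
    qed
  next
    case False
    then have "N \<le> M" by simp
    then show ?thesis
    proof (induction N rule: inc_induct)
      case base
      show ?case by (rule M)
    next
      case (step n)
      then show ?case
        using projection[OF step.IH] by (simp add: take_tuples)
    qed
  qed
qed

lemma definable_not:
  assumes "definable P"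
  shows "definable (\<lambda>e. \<not> P e)"
proof -
  obtain N where N: "depends_below N P" using assms by (rule definableE)
  then have N': "depends_below N (\<lambda>e. \<not> P e)"
    unfolding depends_below_def by blast
  interpret algebra "Rpow N" "\<O> N" by (rule boolean_algebra)
  have "tuples N (\<lambda>e. \<not> P e) = Rpow N - tuples N P"
    unfolding tuples_eq[OF N] tuples_eq[OF N'] by auto
  then show ?thesis
    using tuples_in_structure[OF assms N] by (intro definableI[OF N']) auto
qed

lemma definable_conj:
  assumes "definable P" "definable Q"
  shows "definable (\<lambda>e. P e \<and> Q e)"
proof -
  obtain N1 N2 where "depends_below N1 P" "depends_below N2 Q"
    using assms by (meson definableE)
  then obtain N where N: "depends_below N P" "depends_below N Q"
    by (meson depends_below_mono max.cobounded1 max.cobounded2)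
  then have N': "depends_below N (\<lambda>e. P e \<and> Q e)"
    unfolding depends_below_def by blast
  interpret algebra "Rpow N" "\<O> N" by (rule boolean_algebra)
  have "tuples N (\<lambda>e. P e \<and> Q e) = tuples N P \<inter> tuples N Q"
    unfolding tuples_eq[OF N(1)] tuples_eq[OF N(2)] tuples_eq[OF N'] by auto
  then show ?thesis
    using tuples_in_structure[OF assms(1) N(1)] tuples_in_structure[OF assms(2) N(2)]
    by (intro definableI[OF N']) auto
qed

lemma definable_disj:
  assumes "definable P" "definable Q"
  shows "definable (\<lambda>e. P e \<or> Q e)"
proof -
  have "definable (\<lambda>e. \<not> (\<not> P e \<and> \<not> Q e))"
    by (intro definable_not definable_conj assms)
  then show ?thesis
    unfolding de_Morgan_conj not_not .
qed

lemma definable_imp: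
  assumes "definable P" "definable Q"
  shows "definable (\<lambda>e. P e \<longrightarrow> Q e)"
  unfolding imp_conv_disj by (intro definable_disj definable_not assms)

lemma definable_polynomial:
  assumes "polynomial_fun N f" "depends_below N F" "\<And>xs. length xs = N \<Longrightarrow> F (\<lambda>i. xs ! i) = f xs"
  shows "definable (\<lambda>e. F e = 0)"
proof (rule definableI)
  show N: "depends_below N (\<lambda>e. F e = 0)"
    unfolding depends_below_def
  proof (intro allI impI)
    fix e e' :: "nat \<Rightarrow> real" assume "\<forall>i<N. e i = e' i"
    then have "F e = F e'" by (intro depends_belowD[OF assms(2)]) simp
    then show "(F e = 0) = (F e' = 0)" by simp
  qed
  show "tuples N (\<lambda>e. F e = 0) \<in> \<O> N"
  proof -
    have "tuples N (\<lambda>e. F e = 0) = {xs \<in> Rpow N. f xs = 0}"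
      unfolding tuples_eq[OF N] by (auto simp: assms(3) Rpow_def)
    then show ?thesis
      using zero_set[OF assms(1)] by simp
  qed
qed

lemma definable_const: "definable (\<lambda>e. c)"
proof (cases c)
  case True
  have "definable (\<lambda>e. (0::real) = 0)"
    by (rule definable_polynomial[OF polynomial_fun.const[where p = 0]])
       (auto simp: depends_below_def)
  with True show ?thesis by simp
next
  case False
  have "definable (\<lambda>e. (1::real) = 0)"
    by (rule definable_polynomial[OF polynomial_fun.const[where p = 0]])
       (auto simp: depends_below_def)
  with False show ?thesis by simp
qed

lemma definable_ball:
  assumes "finite S" "\<And>i. i \<in> S \<Longrightarrow> definable (P i)"
  shows "definable (\<lambda>e. \<forall>i\<in>S. P i e)"
  using assms by (induction S rule: finite_induct) (auto intro: definable_const definable_conj)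

text \<open>Existential quantification over the variables from \<open>M\<close> on is an iterated projection,
  because these are the last coordinates.\<close>

lemma definable_ex_top:
  assumes "definable P" "depends_below (M + k) P"
  shows "definable (\<lambda>e. \<exists>f. P (\<lambda>i. if i < M then e i else f i))"
  using assms
proof (induction k arbitrary: P)
  case 0
  have "P (\<lambda>i. if i < M then e i else f i) = P e" for e f
    by (rule depends_belowD[OF 0(2)]) auto
  then show ?case using 0 by simp
next
  case (Suc k)
  let ?Q = "\<lambda>e. \<exists>y. P (e(M + k := y))"
  have Q: "depends_below (M + k) ?Q"
    unfolding depends_below_def
  proof (intro allI impI arg_cong[where f = Ex] ext)
    fix e e' :: "nat \<Rightarrow> real" and y assume "\<forall>i<M + k. e i = e' i"
    then show "P (e(M + k := y)) = P (e'(M + k := y))"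
      by (intro depends_belowD[OF Suc.prems(2)]) (auto simp: less_Suc_eq)
  qed
  have "tuples (M + k) ?Q = tuples (M + k) P"
  proof -
    have "?Q e" if "P e" for e
      using that by (intro exI[of _ "e (M + k)"]) simp
    then show ?thesis
      unfolding tuples_def
    proof (intro set_eqI iffI)
      fix xs assume "xs \<in> {map e [0..<M + k] | e. ?Q e}"
      then obtain e y where "xs = map e [0..<M + k]" "P (e(M + k := y))"
        by blast
      then have "xs = map (e(M + k := y)) [0..<M + k]" "P (e(M + k := y))"
        by auto
      then show "xs \<in> {map e [0..<M + k] | e. P e}"
        by blast
    qed blast
  qed
  also have "\<dots> \<in> \<O> (M + k)"
    using projection[of "tuples (Suc (M + k)) P" "M + k"]
      tuples_in_structure[OF Suc.prems(1), of "Suc (M + k)"] Suc.prems(2)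
    by (simp add: take_tuples)
  finally have "definable ?Q"
    by (rule definableI[OF Q])
  then have "definable (\<lambda>e. \<exists>f. ?Q (\<lambda>i. if i < M then e i else f i))"
    using Q by (rule Suc.IH)
  moreover have "(\<exists>f. ?Q (\<lambda>i. if i < M then e i else f i)) \<longleftrightarrow>
    (\<exists>f. P (\<lambda>i. if i < M then e i else f i))" for e
  proof
    assume "\<exists>f. ?Q (\<lambda>i. if i < M then e i else f i)"
    then obtain f y where fy: "P ((\<lambda>i. if i < M then e i else f i)(M + k := y))" by blast
    have "(\<lambda>i. if i < M then e i else f i)(M + k := y) =
        (\<lambda>i. if i < M then e i else (f(M + k := y)) i)"
      by auto
    with fy have "P (\<lambda>i. if i < M then e i else (f(M + k := y)) i)" by simp
    then show "\<exists>f. P (\<lambda>i. if i < M then e i else f i)" by blast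
  next
    assume "\<exists>f. P (\<lambda>i. if i < M then e i else f i)"
    then obtain f where f: "P (\<lambda>i. if i < M then e i else f i)" by blast
    have "(\<lambda>i. if i < M then e i else f i)(M + k := f (M + k)) = (\<lambda>i. if i < M then e i else f i)"
      by auto
    with f show "\<exists>f. ?Q (\<lambda>i. if i < M then e i else f i)" by metis
  qed
  ultimately show ?case by simp
qed

lemma definable_shift:
  assumes "definable P"
  shows "definable (\<lambda>e. P (\<lambda>i. e (M + i)))"
proof (induction M)
  case 0
  show ?case using assms by simp
next
  case (Suc M)
  let ?Q = "\<lambda>e. P (\<lambda>i. e (M + i))"
  obtain N where N: "depends_below N ?Q" using Suc by (rule definableE)
  have "depends_below (Suc N) (\<lambda>e. ?Q (\<lambda>i. e (Suc i)))"
    unfolding depends_below_def by (intro allI impI depends_belowD[OF N]) auto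
  moreover have "tuples (Suc N) (\<lambda>e. ?Q (\<lambda>i. e (Suc i))) \<in> \<O> (Suc N)"
    unfolding tuples_shift[of N ?Q] by (rule real_times[OF tuples_in_structure[OF Suc N]])
  ultimately have "definable (\<lambda>e. ?Q (\<lambda>i. e (Suc i)))" by (rule definableI)
  then show ?case by simp
qed

text \<open>Substitution amounts to introducing fresh variables \<open>M, M + 1, \<dots>\<close>, equating them with the
  terms to be substituted, and projecting the fresh variables away. It is stated for terms whose
  equations are known to be definable, so that it also yields the renaming of variables, on which the
  notion of a definable term rests.\<close>

lemma definable_substitute:
  assumes P: "definable P" "depends_below N P"
    and T: "\<And>i. i < N \<Longrightarrow> depends_below M (T i)"
    and eq: "\<And>i. i < N \<Longrightarrow> definable (\<lambda>e. e (M + i) = T i e)"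
  shows "definable (\<lambda>e. P (\<lambda>i. T i e))"
proof -
  let ?Q = "\<lambda>e. P (\<lambda>i. e (M + i)) \<and> (\<forall>i\<in>{..<N}. e (M + i) = T i e)"
  have "definable ?Q"
    by (intro definable_conj definable_shift P(1) definable_ball eq) auto
  moreover have "depends_below (M + N) ?Q"
    unfolding depends_below_def
  proof (intro allI impI)
    fix e e' :: "nat \<Rightarrow> real" assume e: "\<forall>i<M + N. e i = e' i"
    have "P (\<lambda>i. e (M + i)) = P (\<lambda>i. e' (M + i))"
      by (rule depends_belowD[OF P(2)]) (use e in auto)
    moreover have "T i e = T i e'" if "i < N" for i
      by (rule depends_belowD[OF T[OF that]]) (use e in auto)
    ultimately show "?Q e = ?Q e'" using e by auto
  qed
  ultimately have "definable (\<lambda>e. \<exists>f. ?Q (\<lambda>i. if i < M then e i else f i))"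
    by (rule definable_ex_top)
  moreover have "(\<exists>f. ?Q (\<lambda>i. if i < M then e i else f i)) \<longleftrightarrow> P (\<lambda>i. T i e)" for e
  proof -
    have T': "T i (\<lambda>i. if i < M then e i else f i) = T i e" if "i < N" for i f
      by (rule depends_belowD[OF T[OF that]]) auto
    show ?thesis
    proof
      assume "\<exists>f. ?Q (\<lambda>i. if i < M then e i else f i)"
      then obtain f where f: "P (\<lambda>i. f (M + i))" "\<forall>i<N. f (M + i) = T i e"
        using T' by auto
      then show "P (\<lambda>i. T i e)"
        using depends_belowD[OF P(2), of "\<lambda>i. f (M + i)" "\<lambda>i. T i e"] by blast
    next
      assume "P (\<lambda>i. T i e)"
      then show "\<exists>f. ?Q (\<lambda>i. if i < M then e i else f i)"
        using T' by (intro exI[of _ "\<lambda>i. T (i - M) e"]) simp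
    qed
  qed
  ultimately show ?thesis by simp
qed

lemma definable_var_eq: "definable (\<lambda>e. e i = e j)"
proof -
  define N where "N = Suc (max i j)"
  have "i < N" "j < N" by (auto simp: N_def)
  have "polynomial_fun N (\<lambda>xs. xs ! i + (-1) * xs ! j)"
    by (intro polynomial_fun.intros \<open>i < N\<close> \<open>j < N\<close>)
  then have "definable (\<lambda>e. e i - e j = 0)"
    by (rule definable_polynomial) (use \<open>i < N\<close> \<open>j < N\<close> in \<open>auto simp: depends_below_def\<close>)
  then show ?thesis by simp
qed

lemma definable_rename:
  assumes "definable P"
  shows "definable (\<lambda>e. P (\<lambda>i. e (\<sigma> i)))"
proof -
  obtain N where N: "depends_below N P" using assms by (rule definableE)
  define M where "M = Suc (Max (\<sigma> ` {..N}))"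
  have "\<sigma> i < M" if "i < N" for i
    using that by (auto simp: M_def less_Suc_eq_le intro!: Max_ge)
  then show ?thesis
    by (intro definable_substitute[OF assms N, of M "\<lambda>i e. e (\<sigma> i)"] definable_var_eq)
       (auto simp: depends_below_def)
qed

text \<open>The variable \<open>N\<close> is one on which the term does not depend, so the equation describes the graph
  of the term.\<close>

definition definable_term :: "((nat \<Rightarrow> real) \<Rightarrow> real) \<Rightarrow> bool" where
  "definable_term F \<longleftrightarrow> (\<exists>N. depends_below N F \<and> definable (\<lambda>e. e N = F e))"

lemma definable_termE:
  assumes "definable_term F"
  obtains N where "depends_below N F" "\<And>M. N \<le> M \<Longrightarrow> definable (\<lambda>e. e M = F e)"
proof -
  obtain N where N: "depends_below N F" "definable (\<lambda>e. e N = F e)"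
    using assms unfolding definable_term_def by blast
  have "definable (\<lambda>e. e M = F e)" for M
  proof -
    have "definable (\<lambda>e. e ((id(N := M)) N) = F (\<lambda>i. e ((id(N := M)) i)))"
      by (rule definable_rename[OF N(2)])
    moreover have "F (\<lambda>i. e ((id(N := M)) i)) = F e" for e
      by (rule depends_belowD[OF N(1)]) auto
    ultimately show ?thesis by simp
  qed
  with N(1) show ?thesis by (rule that)
qed

lemma definable_subst:
  assumes "definable P" "\<And>i. definable_term (T i)"
  shows "definable (\<lambda>e. P (\<lambda>i. T i e))"
proof -
  obtain N where N: "depends_below N P" using assms(1) by (rule definableE)
  have "\<exists>K. depends_below K (T i) \<and> (\<forall>M\<ge>K. definable (\<lambda>e. e M = T i e))" for i
    using definable_termE[OF assms(2)[of i]] by metis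
  then obtain K where K: "\<And>i. depends_below (K i) (T i)"
      "\<And>i M. K i \<le> M \<Longrightarrow> definable (\<lambda>e. e M = T i e)"
    by metis
  define M where "M = Max (K ` {..N})"
  have M: "K i \<le> M" if "i < N" for i
    using that by (auto simp: M_def intro!: Max_ge)
  show ?thesis
    by (rule definable_substitute[OF assms(1) N, of M])
       (auto intro!: K(2) dest!: M intro: depends_below_mono[OF K(1)])
qed

lemma definable_term_var: "definable_term (\<lambda>e. e i)"
  unfolding definable_term_def
  by (intro exI[of _ "Suc i"]) (auto simp: depends_below_def definable_var_eq)

lemma definable_term_subst:
  assumes "definable_term F" "\<And>i. definable_term (T i)"
  shows "definable_term (\<lambda>e. F (\<lambda>i. T i e))"
proof -
  obtain N where N: "depends_below N F" "\<And>M. N \<le> M \<Longrightarrow> definable (\<lambda>e. e M = F e)"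
    using definable_termE[OF assms(1)] by metis
  have "\<exists>K. depends_below K (T i)" for i
    using definable_termE[OF assms(2)[of i]] by metis
  then obtain K where K: "\<And>i. depends_below (K i) (T i)" by metis
  define M where "M = Max (K ` {..N})"
  have T: "depends_below M (T i)" if "i < N" for i
    by (rule depends_below_mono[OF K]) (use that in \<open>auto simp: M_def intro!: Max_ge\<close>)
  have cong: "F (\<lambda>i. T i e) = F (\<lambda>i. T i e')" if "\<forall>i<M. e i = e' i" for e e'
    by (rule depends_belowD[OF N(1)], rule depends_belowD[OF T]) (use that in auto)
  have "definable_term (\<lambda>e. if i = N then e M else T i e)" for i
    by (cases "i = N") (simp_all add: definable_term_var assms(2))
  then have "definable (\<lambda>e. (if N = N then e M else T N e) = F (\<lambda>i. if i = N then e M else T i e))"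
    by (rule definable_subst[OF N(2)[OF order_refl], where T = "\<lambda>i e. if i = N then e M else T i e"])
  moreover have "F (\<lambda>i. if i = N then e M else T i e) = F (\<lambda>i. T i e)" for e
    by (rule depends_belowD[OF N(1)]) auto
  ultimately have "definable (\<lambda>e. e M = F (\<lambda>i. T i e))" by simp
  then show ?thesis
    unfolding definable_term_def using cong by (intro exI[of _ M]) (simp add: depends_below_def)
qed

lemma definable_term_const: "definable_term (\<lambda>e. c)"
proof -
  have "polynomial_fun 1 (\<lambda>xs. xs ! 0 + - c)"
    by (intro polynomial_fun.intros) auto
  then have "definable (\<lambda>e. e 0 - c = 0)"
    by (rule definable_polynomial) (auto simp: depends_below_def)
  then show ?thesis
    unfolding definable_term_def by (intro exI[of _ 0]) (simp add: depends_below_def)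
qed

lemma definable_term_add:
  assumes "definable_term F" "definable_term G"
  shows "definable_term (\<lambda>e. F e + G e)"
proof -
  have "polynomial_fun 3 (\<lambda>xs. xs ! 2 + (-1) * (xs ! 0 + xs ! 1))"
    by (intro polynomial_fun.intros) auto
  then have "definable (\<lambda>e. e 2 - (e 0 + e 1) = 0)"
    by (rule definable_polynomial) (auto simp: depends_below_def)
  then have "definable_term (\<lambda>e. e 0 + e 1)"
    unfolding definable_term_def by (intro exI[of _ 2]) (simp add: depends_below_def)
  then show ?thesis
    using definable_term_subst[of "\<lambda>e. e 0 + e 1" "\<lambda>i. if i = 0 then F else G"] assms by simp
qed

lemma definable_term_mult:
  assumes "definable_term F" "definable_term G"
  shows "definable_term (\<lambda>e. F e * G e)"
proof -
  have "polynomial_fun 3 (\<lambda>xs. xs ! 2 + (-1) * (xs ! 0 * xs ! 1))"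
    by (intro polynomial_fun.intros) auto
  then have "definable (\<lambda>e. e 2 - (e 0 * e 1) = 0)"
    by (rule definable_polynomial) (auto simp: depends_below_def)
  then have "definable_term (\<lambda>e. e 0 * e 1)"
    unfolding definable_term_def by (intro exI[of _ 2]) (simp add: depends_below_def)
  then show ?thesis
    using definable_term_subst[of "\<lambda>e. e 0 * e 1" "\<lambda>i. if i = 0 then F else G"] assms by simp
qed

lemma definable_term_diff:
  assumes "definable_term F" "definable_term G"
  shows "definable_term (\<lambda>e. F e - G e)"
proof -
  have "definable_term (\<lambda>e. F e + - 1 * G e)"
    by (intro definable_term_add definable_term_mult definable_term_const assms)
  then show ?thesis by simp
qed

lemma definable_eq:
  assumes "definable_term F" "definable_term G"
  shows "definable (\<lambda>e. F e = G e)"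
  using definable_subst[OF definable_var_eq[of 0 1], of "\<lambda>i. if i = 0 then F else G"] assms by simp

text \<open>The quantified variables are the de Bruijn indices below \<open>k\<close>. They are renamed to the indices
  from some large \<open>N\<close> on, where projection removes them. Truncating the quantified function makes
  explicit that only its values below \<open>k\<close> matter.\<close>

lemma definable_ex_fun:
  assumes "definable (\<lambda>e. P (\<lambda>i. e (i + k)) (\<lambda>i. if i < k then e i else 0))"
  shows "definable (\<lambda>e. \<exists>f. P e (\<lambda>i. if i < k then f i else 0))"
proof -
  let ?Q = "\<lambda>e. P (\<lambda>i. e (i + k)) (\<lambda>i. if i < k then e i else 0)"
  obtain N where N: "depends_below N ?Q" using assms by (rule definableE)
  let ?R = "\<lambda>e. P e (\<lambda>i. if i < k then e (N + i) else 0)"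
  have "definable (\<lambda>e. ?Q (\<lambda>i. e (if i < k then N + i else i - k)))"
    by (rule definable_rename[OF assms])
  then have R: "definable ?R"
    by (simp cong: if_cong)
  have cong: "P e f = P e' f"
    if "\<And>i. i < N \<Longrightarrow> e i = e' i" "\<And>i. k \<le> i \<Longrightarrow> f i = 0" for e e' f
  proof -
    have "P e f = ?Q (\<lambda>i. if i < k then f i else e (i - k))"
      using that(2) by (auto intro!: arg_cong[where f = "P e"])
    also have "\<dots> = ?Q (\<lambda>i. if i < k then f i else e' (i - k))"
      by (rule depends_belowD[OF N]) (use that(1) in auto)
    also have "\<dots> = P e' f"
      using that(2) by (auto intro!: arg_cong[where f = "P e'"])
    finally show ?thesis .
  qed
  have "depends_below (N + k) ?R"
    unfolding depends_below_def
  proof (intro allI impI)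
    fix e e' :: "nat \<Rightarrow> real" assume e: "\<forall>i<N + k. e i = e' i"
    then have "(\<lambda>i. if i < k then e (N + i) else 0) = (\<lambda>i. if i < k then e' (N + i) else 0)"
      by auto
    then show "?R e = ?R e'"
      using cong[of e e'] e by simp
  qed
  then have "definable (\<lambda>e. \<exists>f. ?R (\<lambda>i. if i < N then e i else f i))"
    by (rule definable_ex_top[OF R])
  moreover have "(\<exists>f. ?R (\<lambda>i. if i < N then e i else f i)) \<longleftrightarrow>
      (\<exists>f. P e (\<lambda>i. if i < k then f i else 0))" for e
  proof -
    have "?R (\<lambda>i. if i < N then e i else f i) \<longleftrightarrow> P e (\<lambda>i. if i < k then f (N + i) else 0)" for f
      using cong[of "\<lambda>i. if i < N then e i else f i" e "\<lambda>i. if i < k then f (N + i) else 0"]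
      by (simp cong: if_cong)
    moreover have "(\<exists>f. P e (\<lambda>i. if i < k then f (N + i) else 0)) \<longleftrightarrow>
        (\<exists>f. P e (\<lambda>i. if i < k then f i else 0))"
    proof
      assume "\<exists>f. P e (\<lambda>i. if i < k then f i else 0)"
      then obtain f where "P e (\<lambda>i. if i < k then f i else 0)" by blast
      then show "\<exists>f. P e (\<lambda>i. if i < k then f (N + i) else 0)"
        by (intro exI[of _ "\<lambda>i. f (i - N)"]) (simp cong: if_cong)
    next
      assume "\<exists>f. P e (\<lambda>i. if i < k then f (N + i) else 0)"
      then obtain f where "P e (\<lambda>i. if i < k then f (N + i) else 0)" by blast
      then show "\<exists>f. P e (\<lambda>i. if i < k then f i else 0)"
        by (intro exI[of _ "\<lambda>i. f (N + i)"]) simp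
    qed
    ultimately show ?thesis by simp
  qed
  ultimately show ?thesis by simp
qed

lemma definable_ex:
  assumes "definable (\<lambda>e. P (\<lambda>i. e (Suc i)) (e 0))"
  shows "definable (\<lambda>e. \<exists>y. P e y)"
proof -
  have "definable (\<lambda>e. \<exists>f::nat \<Rightarrow> real. P e (f 0))"
    using definable_ex_fun[of "\<lambda>e f. P e (f 0)" 1] assms by simp
  moreover have "(\<exists>f::nat \<Rightarrow> real. P e (f 0)) \<longleftrightarrow> (\<exists>y. P e y)" for e
  proof
    assume "\<exists>y. P e y"
    then obtain y where "P e y" ..
    then show "\<exists>f::nat \<Rightarrow> real. P e (f 0)" by (intro exI[of _ "\<lambda>_. y"])
  qed blast
  ultimately show ?thesis by simp
qed

lemma definable_all:
  assumes "definable (\<lambda>e. P (\<lambda>i. e (Suc i)) (e 0))"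
  shows "definable (\<lambda>e. \<forall>y. P e y)"
proof -
  have "definable (\<lambda>e. \<not> (\<exists>y. \<not> P e y))"
    by (intro definable_not definable_ex assms)
  then show ?thesis
    unfolding not_ex not_not .
qed

lemma definable_less:
  assumes "definable_term F" "definable_term G"
  shows "definable (\<lambda>e. F e < G e)"
proof -
  \<comment> \<open>positive numbers are the nonzero squares, so the order is definable from polynomial equations\<close>
  have "definable (\<lambda>e. \<exists>z. z * z * (e 1 - e 0) = 1)"
    by (intro definable_ex definable_eq definable_term_mult definable_term_diff definable_term_const
        definable_term_var)
  moreover have "(\<exists>z. z * z * (y - x) = 1) \<longleftrightarrow> x < y" for x y :: real
  proof
    assume "\<exists>z. z * z * (y - x) = 1"
    then obtain z where "z * z * (y - x) = 1" by blast
    then have "\<not> z * z * (y - x) \<le> 0" by simp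
    then show "x < y"
      using mult_nonneg_nonpos[of "z * z" "y - x"] by (cases "x < y") auto
  next
    assume "x < y"
    then show "\<exists>z. z * z * (y - x) = 1"
      by (intro exI[of _ "1 / sqrt (y - x)"]) (simp add: field_simps)
  qed
  ultimately have "definable (\<lambda>e. e 0 < e 1)" by simp
  then show ?thesis
    using definable_subst[of "\<lambda>e. e 0 < e 1" "\<lambda>i. if i = 0 then F else G"] assms by simp
qed

lemma definable_le:
  assumes "definable_term F" "definable_term G"
  shows "definable (\<lambda>e. F e \<le> G e)"
  unfolding not_less[symmetric] by (intro definable_not definable_less assms)

lemmas definable_intros =
  definable_not definable_conj definable_disj definable_imp definable_const definable_ball
  definable_eq definable_less definable_le definable_ex definable_all
  definable_term_var definable_term_const definable_term_add definable_term_mult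
  definable_term_diff

end

section \<open>Definable subsets of the line and definable functions of one variable\<close>

lemma eventually_at_right_interval:
  fixes I :: "real set"
  assumes "is_interval I"
  shows "(\<forall>\<^sub>F y in at_right t. y \<in> I) \<or> (\<forall>\<^sub>F y in at_right t. y \<notin> I)"
proof (rule disjCI)
  assume "\<not> (\<forall>\<^sub>F y in at_right t. y \<notin> I)"
  then have freq: "\<exists>y\<in>I. t < y \<and> y < b" if "t < b" for b
    using that unfolding eventually_at_right_field by blast
  obtain s where s: "s \<in> I" "t < s" using freq[of "t + 1"] by auto
  have "y \<in> I" if y: "t < y" "y < s" for y
  proof -
    obtain r where "r \<in> I" "t < r" "r < y" using freq[OF y(1)] by blast
    then show ?thesis
      using assms s(1) y unfolding is_interval_1 by (meson less_imp_le)
  qed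
  then show "\<forall>\<^sub>F y in at_right t. y \<in> I"
    using s(2) unfolding eventually_at_right_field by blast
qed

context o_minimal_structure
begin

lemma definable_unary_intervals:
  assumes "definable (\<lambda>e. p (e 0))"
  shows "\<exists>F. finite F \<and> (\<forall>I\<in>F. is_interval I) \<and> Collect p = \<Union>F"
proof -
  have dep: "depends_below 1 (\<lambda>e. p (e 0))"
    by (simp add: depends_below_def)
  have "tuples 1 (\<lambda>e. p (e 0)) = {[t] | t. p t}"
    unfolding tuples_eq[OF dep] by (auto simp: Rpow_def length_Suc_conv)
  moreover have "tuples 1 (\<lambda>e. p (e 0)) \<in> \<O> 1"
    by (rule tuples_in_structure[OF assms dep])
  ultimately obtain F where F: "finite F" "\<forall>I\<in>F. is_interval I"
      "{[t] | t. p t} = {[t] | t. t \<in> \<Union>F}"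
    unfolding dim_one by auto
  have "Collect p = \<Union>F"
  proof (intro set_eqI)
    fix t
    have "[t] \<in> {[t] | t. p t} \<longleftrightarrow> [t] \<in> {[t] | t. t \<in> \<Union>F}"
      unfolding F(3) by (rule refl)
    then show "t \<in> Collect p \<longleftrightarrow> t \<in> \<Union>F" by simp
  qed
  with F(1,2) show ?thesis by (intro exI[of _ F] conjI)
qed

lemma infinite_definable_contains_interval:
  assumes "definable (\<lambda>e. p (e 0))" "infinite (Collect p)"
  obtains a b where "a < b" "\<forall>t\<in>{a<..<b}. p t"
proof -
  obtain F where F: "finite F" "\<forall>I\<in>F. is_interval I" "Collect p = \<Union>F"
    using definable_unary_intervals[of p, OF assms(1)] by (elim exE conjE)
  obtain I where I: "I \<in> F" "infinite I"
    using assms(2) F(1) unfolding F(3) by blast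
  then obtain a where a: "a \<in> I"
    by (metis finite.emptyI ex_in_conv)
  have "infinite (I - {a})" using I(2) by simp
  then obtain b where b: "b \<in> I" "b \<noteq> a"
    by (metis Diff_iff finite.emptyI ex_in_conv singletonI)
  have conv: "t \<in> I" if "x \<in> I" "y \<in> I" "x \<le> t" "t \<le> y" for x y t
    using bspec[OF F(2) I(1)] that unfolding is_interval_1 by blast
  have "p t" if "min a b < t" "t < max a b" for t
  proof -
    have "t \<in> I"
    proof (cases "a \<le> b")
      case True
      then show ?thesis using that by (intro conv[OF a b(1)]) auto
    next
      case False
      then show ?thesis using that by (intro conv[OF b(1) a]) auto
    qed
    then have "t \<in> Collect p" unfolding F(3) using I(1) by blast
    then show ?thesis by simp
  qed
  then show ?thesis
    using b(2) by (intro that[of "min a b" "max a b"]) auto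
qed

lemma definable_eventually_at_right:
  assumes "definable (\<lambda>e. p (e 0))"
  shows "(\<forall>\<^sub>F y in at_right t. p y) \<or> (\<forall>\<^sub>F y in at_right t. \<not> p y)"
proof -
  obtain F where F: "finite F" "\<forall>I\<in>F. is_interval I" "Collect p = \<Union>F"
    using definable_unary_intervals[of p, OF assms(1)] by (elim exE conjE)
  have p: "p y \<longleftrightarrow> (\<exists>I\<in>F. y \<in> I)" for y using F(3) by blast
  show ?thesis
  proof (cases "\<exists>I\<in>F. \<forall>\<^sub>F y in at_right t. y \<in> I")
    case True
    then obtain I where "I \<in> F" "\<forall>\<^sub>F y in at_right t. y \<in> I" by blast
    then have "\<forall>\<^sub>F y in at_right t. p y"
      by (auto simp: p elim: eventually_mono)
    then show ?thesis ..
  next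
    case False
    then have "\<forall>I\<in>F. \<forall>\<^sub>F y in at_right t. y \<notin> I"
      using F(2) eventually_at_right_interval by blast
    then have "\<forall>\<^sub>F y in at_right t. \<forall>I\<in>F. y \<notin> I"
      using F(1) by (simp add: eventually_ball_finite_distrib)
    then show ?thesis by (simp add: p)
  qed
qed

lemma infinite_definable_contains_subinterval:
  assumes "definable (\<lambda>e. p (e 0))" "infinite {t. (a < t \<and> t < b) \<and> p t}"
  obtains a' b' where "a \<le> a'" "a' < b'" "b' \<le> b" "\<forall>t\<in>{a'<..<b'}. p t"
proof -
  have "definable (\<lambda>e. (a < e 0 \<and> e 0 < b) \<and> p (e 0))"
    by (intro definable_intros assms(1))
  then obtain a' b' where ab: "a' < b'"
      "\<forall>t\<in>{a'<..<b'}. (a < t \<and> t < b) \<and> p t"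
    using infinite_definable_contains_interval[of "\<lambda>t. (a < t \<and> t < b) \<and> p t"] assms(2) by metis
  have "a \<le> a'"
  proof (rule ccontr)
    assume "\<not> a \<le> a'"
    then obtain t where "a' < t" "t < min a b'" using dense[of a' "min a b'"] ab(1) by auto
    then show False using bspec[OF ab(2), of t] by auto
  qed
  moreover have "b' \<le> b"
  proof (rule ccontr)
    assume "\<not> b' \<le> b"
    then obtain t where "max a' b < t" "t < b'" using dense[of "max a' b" b'] ab(1) by auto
    then show False using bspec[OF ab(2), of t] by auto
  qed
  ultimately show ?thesis using ab by (intro that) auto
qed

text \<open>The interval is uncountable, so one of the countably many definable sets is infinite within it.
  This replaces quantification over small positive reals by a countable case distinction.\<close>

lemma countable_definable_cover:
  fixes p :: "'k::countable \<Rightarrow> real \<Rightarrow> bool"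
  assumes "\<And>k. definable (\<lambda>e. p k (e 0))" "a < b" "countable C"
    and cover: "\<forall>t\<in>{a<..<b} - C. \<exists>k. p k t"
  obtains k a' b' where "a \<le> a'" "a' < b'" "b' \<le> b" "\<forall>t\<in>{a'<..<b'}. p k t"
proof -
  let ?D = "\<lambda>k. {t. (a < t \<and> t < b) \<and> p k t}"
  have "\<exists>k. infinite (?D k)"
  proof (rule ccontr)
    assume "\<nexists>k. infinite (?D k)"
    then have "countable (C \<union> (\<Union>k. ?D k))"
      using \<open>countable C\<close> by (auto intro: countable_finite)
    moreover have "{a<..<b} \<subseteq> C \<union> (\<Union>k. ?D k)"
    proof
      fix t assume t: "t \<in> {a<..<b}"
      show "t \<in> C \<union> (\<Union>k. ?D k)"
      proof (cases "t \<in> C")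
        case False
        then have "\<exists>k. p k t" using bspec[OF cover, of t] t by simp
        with t show ?thesis by auto
      qed simp
    qed
    ultimately show False
      using uncountable_open_interval[of a b] \<open>a < b\<close> countable_subset by blast
  qed
  then obtain k where "infinite (?D k)" ..
  then show ?thesis
    by (rule infinite_definable_contains_subinterval[of "p k", OF assms(1)]) (rule that)
qed

lemma definable_binary:
  assumes "definable (\<lambda>e. R (e 0) (e 1))" "definable_term F" "definable_term G"
  shows "definable (\<lambda>e. R (F e) (G e))"
proof -
  define T where "T l = (if l = 0 then F else G)" for l :: nat
  have "definable_term (T l)" for l
    using assms(2,3) by (simp add: T_def)
  then have "definable (\<lambda>e. R (T 0 e) (T 1 e))"
    by (rule definable_subst[of "\<lambda>e. R (e 0) (e 1)", OF assms(1)])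
  then show ?thesis by (simp add: T_def)
qed

definition definable_on :: "real \<Rightarrow> real \<Rightarrow> (real \<Rightarrow> real) \<Rightarrow> bool" where
  "definable_on a b f \<longleftrightarrow> definable (\<lambda>e. (a < e 0 \<and> e 0 < b) \<and> f (e 0) = e 1)"

lemma definable_on_subinterval:
  assumes "definable_on a b f" "a \<le> a'" "b' \<le> b"
  shows "definable_on a' b' f"
proof -
  have "definable (\<lambda>e. (a' < e 0 \<and> e 0 < b') \<and> (a < e 0 \<and> e 0 < b) \<and> f (e 0) = e 1)"
    by (rule definable_conj[OF _ assms(1)[unfolded definable_on_def]]) (intro definable_intros)
  moreover have "((a' < t \<and> t < b') \<and> (a < t \<and> t < b) \<and> f t = y) \<longleftrightarrow>
      ((a' < t \<and> t < b') \<and> f t = y)" for t y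
    using assms(2,3) by auto
  ultimately show ?thesis unfolding definable_on_def by simp
qed

text \<open>By o-minimality every point \<open>t\<close> has a right neighbourhood on which the sign of \<open>f y - f t\<close> is
  constant, in the sense that it is always positive or never positive. Its length is at least
  \<open>1 / (n + 1)\<close> for some \<open>n\<close>. The points with a given sign and a given \<open>n\<close> form countably many
  definable sets; one of them contains an interval, and on a piece of that interval shorter than
  \<open>1 / (n + 1)\<close> the function is monotone.\<close>

lemma definable_on_monotone_subinterval:
  assumes f: "definable_on a b f" and "a < b"
  obtains a' b' where "a \<le> a'" "a' < b'" "b' \<le> b"
    "mono_on {a'<..<b'} f \<or> antimono_on {a'<..<b'} f"
proof -
  define G where "G t y \<longleftrightarrow> (a < t \<and> t < b) \<and> f t = y" for t y
  have G: "definable (\<lambda>e. G (e i) (e j))" for i j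
    using f definable_binary[of G, OF _ definable_term_var definable_term_var]
    unfolding definable_on_def G_def by blast
  \<comment> \<open>the first component of the index tells whether values to the right of t are larger than
    the value at t, the second one bounds the length of the neighbourhood from below\<close>
  define D where "D s t \<longleftrightarrow> (\<forall>y u v. t < y \<and> y < t + 1 / Suc (snd s) \<and> G t u \<and> G y v \<longrightarrow>
      (if fst s then u < v else v \<le> u))" for s :: "bool \<times> nat" and t
  have D_definable: "definable (\<lambda>e. D s (e 0))" for s
    unfolding D_def
    by (cases "fst s") (simp_all only: if_True if_False, (intro definable_intros G)+)
  have D_cover: "\<forall>t\<in>{a<..<b} - {}. \<exists>s. D s t"
  proof
    fix t assume "t \<in> {a<..<b} - {}"
    have "definable (\<lambda>e. G t (e i))" for i
      by (rule definable_binary[of G, OF G definable_term_const definable_term_var])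
    then have "definable (\<lambda>e. \<exists>u v. G t u \<and> G (e 0) v \<and> u < v)"
      by (intro definable_conj definable_ex definable_less definable_term_var G)
    then have "(\<forall>\<^sub>F y in at_right t. \<exists>u v. G t u \<and> G y v \<and> u < v) \<or>
        (\<forall>\<^sub>F y in at_right t. \<not> (\<exists>u v. G t u \<and> G y v \<and> u < v))"
      by (rule definable_eventually_at_right)
    then obtain B d where d: "d > t" "\<And>y. t < y \<Longrightarrow> y < d \<Longrightarrow>
        (\<exists>u v. G t u \<and> G y v \<and> u < v) = B"
      unfolding eventually_at_right_field by metis
    obtain n where "inverse (of_nat (Suc n)) < d - t"
      using reals_Archimedean d(1) by (metis diff_gt_0_iff_gt)
    then have n: "t + 1 / Suc n < d" by (simp add: inverse_eq_divide)
    have B: "(u < v) = B" if "t < y" "y < d" "G t u" "G y v" for y u v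
    proof -
      have "(\<exists>u v. G t u \<and> G y v \<and> u < v) = (u < v)"
        using that(3,4) unfolding G_def by auto
      with d(2)[OF that(1,2)] show ?thesis by simp
    qed
    have "D (B, n) t"
      unfolding D_def fst_conv snd_conv
    proof (intro allI impI)
      fix y u v assume "t < y \<and> y < t + 1 / Suc n \<and> G t u \<and> G y v"
      then have "(u < v) = B" using n by (intro B[of y]) auto
      then show "if B then u < v else v \<le> u" by auto
    qed
    then show "\<exists>s. D s t" ..
  qed
  obtain s a' b' where ab: "a \<le> a'" "a' < b'" "b' \<le> b"
      and D: "\<forall>t\<in>{a'<..<b'}. D s t"
    by (rule countable_definable_cover[of D a b "{}", OF D_definable \<open>a < b\<close> countable_empty D_cover])
       blast
  define c where "c = min b' (a' + 1 / Suc (snd s))"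
  have c: "a' < c" "c \<le> b'" using ab(2) by (auto simp: c_def)
  have rel: "if fst s then f x < f y else f y \<le> f x" if "a' < x" "x < y" "y < c" for x y
  proof -
    have "D s x" "y < x + 1 / Suc (snd s)" "a < x" "x < b" "a < y" "y < b"
      using that ab c bspec[OF D, of x] by (auto simp: c_def)
    then show ?thesis
      using that unfolding D_def G_def by blast
  qed
  have "mono_on {a'<..<c} f \<or> antimono_on {a'<..<c} f"
  proof (cases "fst s")
    case True
    then have "mono_on {a'<..<c} f"
      using rel by (intro mono_onI) (force simp: le_less)
    then show ?thesis ..
  next
    case False
    then have "antimono_on {a'<..<c} f"
      using rel by (intro monotone_onI) (force simp: le_less)
    then show ?thesis ..
  qed
  moreover have "c \<le> b" using ab(3) c(2) by simp
  ultimately show ?thesis using ab(1) c(1) by (intro that)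
qed

text \<open>If some rational lies in infinitely many fibres, it is a constant selection on a subinterval.
  Otherwise only countably many fibres contain a rational. The others contain no interval and so are
  finite, and their minimum is a definable selection.\<close>

lemma definable_choice:
  assumes R: "definable (\<lambda>e. R (e 0) (e 1))" and "a < b"
    and ex: "\<forall>t\<in>{a<..<b}. \<exists>y. R t y"
  obtains a' b' f where "a \<le> a'" "a' < b'" "b' \<le> b" "definable_on a' b' f"
    "\<forall>t\<in>{a'<..<b'}. R t (f t)"
proof (cases "\<exists>q\<in>\<rat>. infinite {t. (a < t \<and> t < b) \<and> R t q}")
  case True
  then obtain q where "infinite {t. (a < t \<and> t < b) \<and> R t q}" by blast
  then obtain a' b' where "a \<le> a'" "a' < b'" "b' \<le> b" "\<forall>t\<in>{a'<..<b'}. R t q"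
    by (rule infinite_definable_contains_subinterval[of "\<lambda>t. R t q",
          OF definable_binary[of R, OF R definable_term_var definable_term_const]]) blast
  moreover have "definable_on a' b' (\<lambda>_. q)"
    unfolding definable_on_def by (intro definable_intros)
  ultimately show ?thesis by (intro that)
next
  case False
  define C where "C = (\<Union>q\<in>\<rat>. {t. (a < t \<and> t < b) \<and> R t q})"
  have "countable C"
    unfolding C_def using False by (intro countable_UN countable_rat) (auto intro: countable_finite)
  define p where "p t y \<longleftrightarrow> R t y \<and> (\<forall>z. R t z \<longrightarrow> y \<le> z)" for t y
  have R': "definable (\<lambda>e. R (e i) (e j))" for i j
    by (rule definable_binary[of R, OF R definable_term_var definable_term_var])
  have p: "definable (\<lambda>e. p (e i) (e j))" for i j
    unfolding p_def by (intro definable_intros R')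
  have p_ex: "\<forall>t\<in>{a<..<b} - C. \<exists>k::unit. \<exists>y. p t y"
  proof (intro ballI exI)
    fix t assume t: "t \<in> {a<..<b} - C"
    have "finite (Collect (R t))"
    proof (rule ccontr)
      assume "infinite (Collect (R t))"
      then obtain c d where cd: "c < d" "\<forall>y\<in>{c<..<d}. R t y"
        by (rule infinite_definable_contains_interval[of "R t",
              OF definable_binary[of R, OF R definable_term_const definable_term_var]]) blast
      then obtain q where "q \<in> \<rat>" "c < q" "q < d"
        using Rats_dense_in_real by blast
      then show False
        using cd(2) t unfolding C_def by auto
    qed
    moreover have "Collect (R t) \<noteq> {}" using ex t by blast
    ultimately show "p t (Min (Collect (R t)))"
      unfolding p_def using Min_in[of "Collect (R t)"] Min_le[of "Collect (R t)"] by simp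
  qed
  have p_ex_definable: "definable (\<lambda>e. \<exists>y. p (e 0) y)"
    by (intro definable_ex p)
  obtain a' b' where ab: "a \<le> a'" "a' < b'" "b' \<le> b"
      "\<forall>t\<in>{a'<..<b'}. \<exists>y. p t y"
    by (rule countable_definable_cover[of "\<lambda>_::unit. \<lambda>t. \<exists>y. p t y" a b C,
          OF p_ex_definable \<open>a < b\<close> \<open>countable C\<close> p_ex]) blast
  define f where "f t = (THE y. p t y)" for t
  have f: "f t = y \<longleftrightarrow> p t y" if t: "t \<in> {a'<..<b'}" for t y
  proof -
    have uniq: "y = y'" if "p t y" "p t y'" for y y'
      using that unfolding p_def by (meson antisym)
    obtain y0 where "p t y0" using bspec[OF ab(4) t] ..
    then have "f t = y0" unfolding f_def using uniq by (intro the_equality) auto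
    then show ?thesis using \<open>p t y0\<close> uniq by blast
  qed
  have "definable (\<lambda>e. (a' < e 0 \<and> e 0 < b') \<and> p (e 0) (e 1))"
    by (intro definable_intros p)
  moreover have "((a' < t \<and> t < b') \<and> p t y) \<longleftrightarrow> ((a' < t \<and> t < b') \<and> f t = y)" for t y
    using f[of t y] by auto
  ultimately have "definable_on a' b' f"
    unfolding definable_on_def by simp
  moreover have "\<forall>t\<in>{a'<..<b'}. R t (f t)"
    using f p_def by blast
  ultimately show ?thesis using ab by (intro that)
qed

section \<open>Curves with monotone coordinates\<close>

text \<open>Variable \<open>0\<close> is the parameter. The remaining variables are eliminated from the last one down:
  a definable choice of the last variable, monotone on a smaller interval, is substituted into the
  predicate, which leaves one variable less.\<close>

lemma definable_monotone_curve:
  assumes "definable P" "depends_below (Suc k) P" "a < b"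
    and "\<forall>t\<in>{a<..<b}. \<exists>e. e 0 = t \<and> P e"
  shows "\<exists>a' b' X. a \<le> a' \<and> a' < b' \<and> b' \<le> b \<and> (\<forall>t\<in>{a'<..<b'}. X t 0 = t \<and> P (X t)) \<and>
    (\<forall>i. mono_on {a'<..<b'} (\<lambda>t. X t i) \<or> antimono_on {a'<..<b'} (\<lambda>t. X t i))"
  using assms
proof (induction k arbitrary: P a b)
  case 0
  define X :: "real \<Rightarrow> nat \<Rightarrow> real" where "X t i = (if i = 0 then t else 0)" for t i
  have "X t 0 = t \<and> P (X t)" if t: "t \<in> {a<..<b}" for t
  proof -
    obtain e where "e 0 = t" "P e" using bspec[OF "0.prems"(4) t] by blast
    moreover have "P e = P (X t)"
      by (rule depends_belowD[OF "0.prems"(2)]) (simp add: X_def \<open>e 0 = t\<close>)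
    ultimately show ?thesis by (simp add: X_def)
  qed
  moreover have "mono_on {a<..<b} (\<lambda>t. X t i)" for i
    by (cases "i = 0") (auto simp: X_def intro!: mono_onI)
  ultimately show ?case
    using \<open>a < b\<close> by (intro exI[of _ a] exI[of _ b] exI[of _ X]) simp
next
  case (Suc k)
  define v where "v = Suc k"
  define R where "R t y \<longleftrightarrow> (\<exists>e. e 0 = t \<and> e v = y \<and> P e)" for t y
  have R_iff: "R t y \<longleftrightarrow>
      (\<exists>f. P (\<lambda>i. if i = 0 then t else if i = v then y else (if i < v then f i else 0)))" for t y
  proof
    assume "R t y"
    then obtain e where e: "e 0 = t" "e v = y" "P e" unfolding R_def by blast
    have "P e = P (\<lambda>i. if i = 0 then t else if i = v then y else (if i < v then e i else 0))"
      by (rule depends_belowD[OF Suc.prems(2)]) (use e in \<open>auto simp: v_def\<close>)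
    with e(3) show "\<exists>f. P (\<lambda>i. if i = 0 then t else if i = v then y else (if i < v then f i else 0))"
      by blast
  next
    assume "\<exists>f. P (\<lambda>i. if i = 0 then t else if i = v then y else (if i < v then f i else 0))"
    then obtain f where f: "P (\<lambda>i. if i = 0 then t else if i = v then y else (if i < v then f i else 0))" ..
    show "R t y"
      unfolding R_def by (rule exI, intro conjI, rule_tac [3] f) (auto simp: v_def)
  qed
  have T: "definable_term (\<lambda>e. if i = 0 then e v else if i = v then e (Suc v)
      else (if i < v then e i else 0))" for i
    by (cases "i = 0"; cases "i = v"; cases "i < v")
      (simp_all add: definable_term_var definable_term_const)
  have "definable (\<lambda>e. P (\<lambda>i. if i = 0 then e v else if i = v then e (Suc v)
      else (if i < v then e i else 0)))"
    by (rule definable_subst[of P, OF Suc.prems(1) T])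
  then have "definable (\<lambda>e. \<exists>f. P (\<lambda>i. if i = 0 then e 0 else if i = v then e 1
      else (if i < v then f i else 0)))"
    by (intro definable_ex_fun[of "\<lambda>e f. P (\<lambda>i. if i = 0 then e 0 else if i = v then e 1
      else f i)" v]) (simp cong: if_cong)
  then have "definable (\<lambda>e. R (e 0) (e 1))"
    unfolding R_iff .
  moreover have "\<forall>t\<in>{a<..<b}. \<exists>y. R t y"
    using Suc.prems(4) unfolding R_def by blast
  ultimately obtain a1 b1 f where 1: "a \<le> a1" "a1 < b1" "b1 \<le> b" "definable_on a1 b1 f"
      "\<forall>t\<in>{a1<..<b1}. R t (f t)"
    by (rule definable_choice[of R, OF _ \<open>a < b\<close>])
  obtain a2 b2 where 2: "a1 \<le> a2" "a2 < b2" "b2 \<le> b1"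
      "mono_on {a2<..<b2} f \<or> antimono_on {a2<..<b2} f"
    by (rule definable_on_monotone_subinterval[OF 1(4) 1(2)])
  have f: "definable (\<lambda>e. (a2 < e 0 \<and> e 0 < b2) \<and> f (e 0) = e 1)"
    using definable_on_subinterval[OF 1(4) 2(1,3)] unfolding definable_on_def .
  define P' where "P' e \<longleftrightarrow> (a2 < e 0 \<and> e 0 < b2) \<and> P (e(v := f (e 0)))" for e
  have "definable P'"
  proof -
    have "definable (\<lambda>e. P (\<lambda>i. e (if i = v then 0 else Suc i)))"
      by (rule definable_rename[OF Suc.prems(1)])
    moreover have "(\<lambda>i. e (if i = v then 0 else Suc i)) = (\<lambda>i. e (Suc i))(v := e 0)"
      for e :: "nat \<Rightarrow> real"
      by auto
    ultimately have "definable (\<lambda>e. P ((\<lambda>i. e (Suc i))(v := e 0)))" by (simp only:)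
    moreover have "definable (\<lambda>e. (a2 < e (Suc 0) \<and> e (Suc 0) < b2) \<and> f (e (Suc 0)) = e 0)"
      by (rule definable_binary[of "\<lambda>t y. (a2 < t \<and> t < b2) \<and> f t = y",
            OF f definable_term_var definable_term_var])
    ultimately have "definable (\<lambda>e. \<exists>y. ((a2 < e 0 \<and> e 0 < b2) \<and> f (e 0) = y) \<and> P (e(v := y)))"
      by (intro definable_ex definable_conj[of "\<lambda>e. (a2 < e (Suc 0) \<and> e (Suc 0) < b2) \<and> f (e (Suc 0)) = e 0"])
    moreover have "(\<exists>y. ((a2 < e 0 \<and> e 0 < b2) \<and> f (e 0) = y) \<and> P (e(v := y))) = P' e" for e
      unfolding P'_def by blast
    ultimately show ?thesis by simp
  qed
  moreover have "depends_below (Suc k) P'"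
    unfolding depends_below_def
  proof (intro allI impI)
    fix e e' :: "nat \<Rightarrow> real" assume e: "\<forall>i<Suc k. e i = e' i"
    have "P (e(v := f (e 0))) = P (e'(v := f (e' 0)))"
      by (rule depends_belowD[OF Suc.prems(2)]) (use e in \<open>auto simp: v_def less_Suc_eq\<close>)
    then show "P' e = P' e'" using e by (simp add: P'_def)
  qed
  moreover have "\<forall>t\<in>{a2<..<b2}. \<exists>e. e 0 = t \<and> P' e"
  proof
    fix t assume t: "t \<in> {a2<..<b2}"
    then have "R t (f t)" using bspec[OF 1(5), of t] 2 by simp
    then obtain e where e: "e 0 = t" "e v = f t" "P e" unfolding R_def by blast
    then have "e(v := f (e 0)) = e" by auto
    then show "\<exists>e. e 0 = t \<and> P' e" using e t by (intro exI[of _ e]) (simp add: P'_def)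
  qed
  ultimately obtain a' b' X where X: "a2 \<le> a'" "a' < b'" "b' \<le> b2"
      "\<forall>t\<in>{a'<..<b'}. X t 0 = t \<and> P' (X t)"
      "\<forall>i. mono_on {a'<..<b'} (\<lambda>t. X t i) \<or> antimono_on {a'<..<b'} (\<lambda>t. X t i)"
    using Suc.IH[of P' a2 b2] \<open>a2 < b2\<close> by blast
  define Y where "Y t = (X t)(v := f t)" for t
  have "Y t 0 = t \<and> P (Y t)" if "t \<in> {a'<..<b'}" for t
  proof -
    have "X t 0 = t" "P' (X t)" using bspec[OF X(4) that] by simp_all
    then show ?thesis unfolding Y_def P'_def by (simp add: v_def)
  qed
  moreover have "mono_on {a'<..<b'} (\<lambda>t. Y t i) \<or> antimono_on {a'<..<b'} (\<lambda>t. Y t i)" for i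
  proof (cases "i = v")
    case True
    have "{a'<..<b'} \<subseteq> {a2<..<b2}" using X(1,3) by auto
    with 2(4) show ?thesis
      unfolding Y_def True by (auto intro: monotone_on_subset)
  next
    case False
    then show ?thesis using X(5) by (simp add: Y_def)
  qed
  moreover have "a \<le> a'" "b' \<le> b" using 1 2 X by auto
  ultimately show ?case
    using \<open>a' < b'\<close> by blast
qed

end

section \<open>Difference quotients and descent directions\<close>

text \<open>If near every point of \<open>[c, d]\<close> all slopes exceeded the mean slope plus \<open>1\<close>, these local
  estimates would add up to a global increase of \<open>h\<close> larger than \<open>h d - h c\<close>.\<close>

lemma bounded_slope_point:
  fixes h :: "real \<Rightarrow> real"
  assumes "a < c" "c < d" "d < b"
  shows "\<exists>K. \<exists>t\<in>{c..d}. \<forall>\<delta>>0. \<exists>s\<in>{a<..<b}.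
    s \<noteq> t \<and> \<bar>s - t\<bar> < \<delta> \<and> (h s - h t) / (s - t) \<le> K"
proof -
  define K where "K = (h d - h c) / (d - c) + 1"
  define Q where "Q t \<longleftrightarrow> (\<forall>\<delta>>0. \<exists>s\<in>{a<..<b}.
    s \<noteq> t \<and> \<bar>s - t\<bar> < \<delta> \<and> (h s - h t) / (s - t) \<le> K)" for t
  have "\<exists>t\<in>{c..d}. Q t"
  proof (rule ccontr)
    assume contr: "\<not> ?thesis"
    define P where "P x y \<longleftrightarrow> K * (y - x) \<le> h y - h x" for x y
    have "P c d"
    proof (rule Bolzano)
      show "c \<le> d" using assms by simp
    next
      fix x y z
      assume "P x y" "P y z"
      then show "P x z" by (simp add: P_def algebra_simps)
    next
      fix t assume t: "c \<le> t" "t \<le> d"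
      have "\<not> Q t" using contr t by auto
      then obtain \<delta> where \<delta>: "\<delta> > 0"
          "\<And>s. s \<in> {a<..<b} \<Longrightarrow> s \<noteq> t \<Longrightarrow> \<bar>s - t\<bar> < \<delta> \<Longrightarrow> K < (h s - h t) / (s - t)"
        unfolding Q_def by (metis not_le)
      define r where "r = min \<delta> (min (c - a) (b - d))"
      have right: "K * (y - t) \<le> h y - h t" if "t \<le> y" "y < t + r" for y
      proof (cases "y = t")
        case False
        then have "K < (h y - h t) / (y - t)"
          using that assms t by (intro \<delta>(2)) (auto simp: r_def)
        then show ?thesis using False that by (simp add: field_simps)
      qed simp
      have left: "K * (t - x) \<le> h t - h x" if "x \<le> t" "t - r < x" for x
      proof (cases "x = t")
        case False
        then have "K < (h x - h t) / (x - t)"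
          using that assms t by (intro \<delta>(2)) (auto simp: r_def)
        also have "\<dots> = (h t - h x) / (t - x)"
          by (metis minus_diff_eq minus_divide_divide)
        finally show ?thesis using False that by (simp add: field_simps)
      qed simp
      have "P x y" if "x \<le> t \<and> t \<le> y \<and> y - x < r" for x y
        using left[of x] right[of y] that by (simp add: P_def algebra_simps)
      moreover have "r > 0" using \<delta>(1) assms by (auto simp: r_def)
      ultimately show "\<exists>r>0. \<forall>x y. x \<le> t \<and> t \<le> y \<and> y - x < r \<longrightarrow> P x y"
        by blast
    qed
    moreover have "K * (d - c) = h d - h c + (d - c)"
      using assms by (simp add: K_def distrib_right)
    ultimately show False
      using assms by (simp add: P_def)
  qed
  then show ?thesis unfolding Q_def ..
qed

text \<open>Reversing the sign of the decreasing coordinates and adding up gives an increasing function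
  \<open>h\<close> with \<open>norm (\<phi> y - \<phi> x) \<le> h y - h x\<close> for \<open>x \<le> y\<close>. Bounded slopes of \<open>h\<close> along a sequence give
  bounded difference quotients of \<open>\<phi>\<close>, and compactness a limit.\<close>

lemma monotone_curve_difference_quotient:
  fixes \<phi> :: "real \<Rightarrow> real ^ 'n"
  assumes "a < b"
    and mono: "\<And>i. mono_on {a<..<b} (\<lambda>t. \<phi> t $ i) \<or> antimono_on {a<..<b} (\<lambda>t. \<phi> t $ i)"
  obtains t s v where "t \<in> {a<..<b}" "\<forall>k. s k \<in> {a<..<b} \<and> s k \<noteq> t" "s \<longlonglongrightarrow> t"
    "(\<lambda>k. inverse (s k - t) *\<^sub>R (\<phi> (s k) - \<phi> t)) \<longlonglongrightarrow> v"
proof -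
  define \<sigma> :: "'n \<Rightarrow> real" where "\<sigma> i = (if mono_on {a<..<b} (\<lambda>t. \<phi> t $ i) then 1 else -1)" for i
  define h where "h t = (\<Sum>i\<in>UNIV. \<sigma> i * \<phi> t $ i)" for t
  have le: "norm (\<phi> y - \<phi> x) \<le> h y - h x" if "x \<in> {a<..<b}" "y \<in> {a<..<b}" "x \<le> y" for x y
  proof -
    have "\<bar>\<phi> y $ i - \<phi> x $ i\<bar> = \<sigma> i * (\<phi> y $ i - \<phi> x $ i)" for i
    proof (cases "mono_on {a<..<b} (\<lambda>t. \<phi> t $ i)")
      case True
      then show ?thesis using monotone_onD[OF True that] by (simp add: \<sigma>_def)
    next
      case False
      then have "antimono_on {a<..<b} (\<lambda>t. \<phi> t $ i)" using mono by blast
      from monotone_onD[OF this that] False show ?thesis by (simp add: \<sigma>_def)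
    qed
    then have "(\<Sum>i\<in>UNIV. \<bar>(\<phi> y - \<phi> x) $ i\<bar>) = h y - h x"
      by (simp add: h_def right_diff_distrib sum_subtractf)
    then show ?thesis using norm_le_l1_cart[of "\<phi> y - \<phi> x"] by simp
  qed
  define c d where "c = a + (b - a) / 3" and "d = b - (b - a) / 3"
  have cd: "a < c" "c < d" "d < b" using \<open>a < b\<close> by (auto simp: c_def d_def field_simps)
  obtain K t where t: "t \<in> {c..d}" and K: "\<And>\<delta>. 0 < \<delta> \<Longrightarrow>
      \<exists>s\<in>{a<..<b}. s \<noteq> t \<and> \<bar>s - t\<bar> < \<delta> \<and> (h s - h t) / (s - t) \<le> K"
    using bounded_slope_point[OF cd, of h] by blast
  have t': "t \<in> {a<..<b}" using t cd by simp
  have "\<exists>s. s \<in> {a<..<b} \<and> s \<noteq> t \<and> \<bar>s - t\<bar> < inverse (real (Suc k)) \<and> (h s - h t) / (s - t) \<le> K" for k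
    using K[of "inverse (real (Suc k))"] by (simp add: Bex_def)
  then obtain s where s: "\<And>k. s k \<in> {a<..<b}" "\<And>k. s k \<noteq> t"
      "\<And>k. \<bar>s k - t\<bar> < inverse (real (Suc k))" "\<And>k. (h (s k) - h t) / (s k - t) \<le> K"
    by metis
  have lim: "s \<longlonglongrightarrow> t"
  proof (rule LIM_zero_cancel, rule tendsto_rabs_zero_cancel)
    show "(\<lambda>k. \<bar>s k - t\<bar>) \<longlonglongrightarrow> 0"
    proof (rule tendsto_sandwich[OF _ _ tendsto_const LIMSEQ_inverse_real_of_nat])
      show "\<forall>\<^sub>F k in sequentially. \<bar>s k - t\<bar> \<le> inverse (real (Suc k))"
        by (intro always_eventually allI less_imp_le s(3))
    qed simp
  qed
  define q where "q k = inverse (s k - t) *\<^sub>R (\<phi> (s k) - \<phi> t)" for k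
  have "norm (q k) \<le> K" for k
  proof -
    have "norm (\<phi> (s k) - \<phi> t) / \<bar>s k - t\<bar> \<le> (h (s k) - h t) / (s k - t)"
    proof (cases "t \<le> s k")
      case True
      then show ?thesis using le[OF t' s(1)[of k]] by (simp add: divide_right_mono)
    next
      case False
      then have "norm (\<phi> (s k) - \<phi> t) / (t - s k) \<le> (h t - h (s k)) / (t - s k)"
        using le[OF s(1)[of k] t'] by (intro divide_right_mono) (simp_all add: norm_minus_commute)
      also have "\<dots> = (h (s k) - h t) / (s k - t)"
        by (metis minus_diff_eq minus_divide_divide)
      finally show ?thesis using False by simp
    qed
    also have "\<dots> \<le> K" by (rule s(4))
    finally show ?thesis by (simp add: q_def divide_inverse mult.commute)
  qed
  then have "bounded (range q)" by (auto simp: bounded_iff)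
  then obtain v r where r: "strict_mono r" "(q \<circ> r) \<longlonglongrightarrow> v"
    using bounded_imp_convergent_subsequence by blast
  show ?thesis
  proof (rule that[of t "s \<circ> r" v])
    show "(\<lambda>k. inverse ((s \<circ> r) k - t) *\<^sub>R (\<phi> ((s \<circ> r) k) - \<phi> t)) \<longlonglongrightarrow> v"
      using r(2) by (simp add: q_def comp_def)
    show "(s \<circ> r) \<longlonglongrightarrow> t" by (rule LIMSEQ_subseq_LIMSEQ[OF lim r(1)])
  qed (use t' s in auto)
qed

text \<open>Convergence of the quotients forces \<open>y k\<close> to tend to \<open>x\<close>, with an error term in the expansion
  of \<open>f\<close> at \<open>x\<close> of order \<open>o(s k - t)\<close>.\<close>

lemma gderiv_along_sequence:
  fixes f :: "'a::real_inner \<Rightarrow> real"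
  assumes f: "GDERIV f x :> D"
    and s: "\<And>k. s k \<noteq> t" "s \<longlonglongrightarrow> t"
    and q: "(\<lambda>k. inverse (s k - t) *\<^sub>R (y k - x)) \<longlonglongrightarrow> v"
    and val: "\<And>k. f (y k) - f x = c * (s k - t)"
  shows "inner v D = c"
proof -
  let ?q = "\<lambda>k. inverse (s k - t) *\<^sub>R (y k - x)"
  have der: "(f has_derivative (\<lambda>h. inner h D)) (at x)" using f unfolding gderiv_def .
  have y: "y k - x = (s k - t) *\<^sub>R ?q k" for k using s(1)[of k] by simp
  have "(\<lambda>k. (s k - t) *\<^sub>R ?q k) \<longlonglongrightarrow> 0 *\<^sub>R v"
    using s(2) by (intro tendsto_scaleR q) (simp add: LIM_zero)
  then have "(\<lambda>k. y k - x) \<longlonglongrightarrow> 0" unfolding y[symmetric] by simp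
  then have y_lim: "y \<longlonglongrightarrow> x" by (rule LIM_zero_cancel)
  obtain B where B: "B > 0" "\<And>k. norm (?q k) \<le> B"
    using Bseq_eq_bounded convergent_imp_Bseq[OF convergentI[OF q]] unfolding Bseq_def by blast
  have "(\<lambda>k. c - inner (?q k) D) \<longlonglongrightarrow> 0"
  proof (rule LIMSEQ_I)
    fix r :: real assume "r > 0"
    define \<epsilon> where "\<epsilon> = r / (2 * B)"
    have "\<epsilon> > 0" using \<open>r > 0\<close> B(1) by (simp add: \<epsilon>_def)
    then obtain d where d: "d > 0" "\<And>z. norm (z - x) < d \<Longrightarrow>
        norm (f z - f x - inner (z - x) D) \<le> \<epsilon> * norm (z - x)"
      using der unfolding has_derivative_at_alt by blast
    obtain N where N: "\<And>k. N \<le> k \<Longrightarrow> norm (y k - x) < d"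
      using LIMSEQ_D[OF y_lim d(1)] by blast
    have "norm (c - inner (?q k) D - 0) < r" if "N \<le> k" for k
    proof -
      have "(s k - t) * (c - inner (?q k) D) = f (y k) - f x - inner (y k - x) D"
      proof -
        have "inner (y k - x) D = (s k - t) * inner (?q k) D"
          using s(1)[of k] by simp
        then show ?thesis
          unfolding val[of k] by (simp only: right_diff_distrib mult.commute)
      qed
      then have "\<bar>s k - t\<bar> * \<bar>c - inner (?q k) D\<bar> \<le> \<epsilon> * norm (y k - x)"
        using d(2)[OF N[OF that]] by (metis abs_mult real_norm_def)
      also have "norm (y k - x) = \<bar>s k - t\<bar> * norm (?q k)"
        by (subst y) (simp only: norm_scaleR)
      also have "\<epsilon> * (\<bar>s k - t\<bar> * norm (?q k)) \<le> \<epsilon> * (\<bar>s k - t\<bar> * B)"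
        using \<open>\<epsilon> > 0\<close> B(2) by (intro mult_left_mono) auto
      finally have "\<bar>s k - t\<bar> * \<bar>c - inner (?q k) D\<bar> \<le> \<bar>s k - t\<bar> * (r / 2)"
        using B(1) by (simp add: \<epsilon>_def field_simps)
      then have "\<bar>c - inner (?q k) D\<bar> \<le> r / 2"
        using s(1)[of k] by (simp add: mult_le_cancel_left)
      then show ?thesis using \<open>r > 0\<close> by simp
    qed
    then show "\<exists>N. \<forall>k\<ge>N. norm (c - inner (?q k) D - 0) < r" by blast
  qed
  moreover have "(\<lambda>k. c - inner (?q k) D) \<longlonglongrightarrow> c - inner v D"
    by (intro tendsto_diff tendsto_const tendsto_inner q)
  ultimately have "c - inner v D = 0" using LIMSEQ_unique by blast
  then show ?thesis by simp
qed

text \<open>The right-hand side avoids derivatives, so that it is a formula in the values of the \<open>g i\<close>. The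
  condition is homogeneous in \<open>y\<close>: a descent direction can be lengthened until all finitely many
  directional derivatives are below \<open>-1\<close>.\<close>

lemma strict_descent_iff:
  fixes g :: "'i \<Rightarrow> 'a::euclidean_space \<Rightarrow> real"
  assumes "finite I" "\<And>i. i \<in> I \<Longrightarrow> g i differentiable (at x)"
  shows "(\<exists>y. \<forall>i\<in>I. inner y (gradient (g i) x) < 0) \<longleftrightarrow>
    (\<exists>y \<delta>. 0 < \<delta> \<and> (\<forall>s. 0 < s \<and> s < \<delta> \<longrightarrow> (\<forall>i\<in>I. g i (x + s *\<^sub>R y) \<le> g i x - s)))"
proof -
  have quotient: "((\<lambda>s. (g i (x + s *\<^sub>R y) - g i x) / s) \<longlongrightarrow> inner y (gradient (g i) x)) (at_right 0)"
    if "i \<in> I" for i y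
  proof -
    have "(g i has_derivative (\<lambda>h. inner h (gradient (g i) x))) (at (x + 0 *\<^sub>R y))"
      using gderiv_gradient[OF assms(2)[OF that]] by (simp add: gderiv_def)
    moreover have "((\<lambda>s. x + s *\<^sub>R y) has_derivative (\<lambda>s. s *\<^sub>R y)) (at 0)"
      by (auto intro!: derivative_eq_intros)
    ultimately have "((\<lambda>s. g i (x + s *\<^sub>R y)) has_derivative
        (\<lambda>s. inner (s *\<^sub>R y) (gradient (g i) x))) (at 0)"
      by (rule has_derivative_compose[rotated])
    moreover have "(\<lambda>s. inner (s *\<^sub>R y) (gradient (g i) x)) = (*) (inner y (gradient (g i) x))"
      by (auto simp: mult.commute)
    ultimately have "((\<lambda>s. g i (x + s *\<^sub>R y)) has_field_derivative inner y (gradient (g i) x)) (at 0)"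
      unfolding has_field_derivative_def by simp
    then have "((\<lambda>s. (g i (x + s *\<^sub>R y) - g i x) / s) \<longlongrightarrow> inner y (gradient (g i) x)) (at 0)"
      unfolding DERIV_def by simp
    then show ?thesis by (rule filterlim_mono) (auto simp: at_le)
  qed
  show ?thesis
  proof
    assume "\<exists>y. \<forall>i\<in>I. inner y (gradient (g i) x) < 0"
    then obtain y where y: "\<forall>i\<in>I. inner y (gradient (g i) x) < 0" ..
    \<comment> \<open>the sum of the reciprocals is at least each of them, so it bounds the factor needed for
      each single derivative\<close>
    define c where "c = 1 + (\<Sum>i\<in>I. 1 / - inner y (gradient (g i) x))"
    have "inner (c *\<^sub>R y) (gradient (g i) x) < -1" if i: "i \<in> I" for i
    proof -
      have "1 / - inner y (gradient (g i) x) \<le> (\<Sum>i\<in>I. 1 / - inner y (gradient (g i) x))"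
        using y by (intro member_le_sum[OF i _ assms(1)]) (force simp: divide_le_0_iff)
      then have "1 / - inner y (gradient (g i) x) < c" by (simp add: c_def)
      then show ?thesis using bspec[OF y i] by (simp add: field_simps)
    qed
    then have "\<forall>i\<in>I. \<forall>\<^sub>F s in at_right 0. (g i (x + s *\<^sub>R (c *\<^sub>R y)) - g i x) / s < -1"
      by (intro ballI order_tendstoD(2)[OF quotient])
    then have "\<forall>\<^sub>F s in at_right 0. \<forall>i\<in>I. (g i (x + s *\<^sub>R (c *\<^sub>R y)) - g i x) / s < -1"
      using assms(1) by (simp add: eventually_ball_finite_distrib)
    then obtain \<delta> where \<delta>: "\<delta> > 0" "\<And>s. 0 < s \<Longrightarrow> s < \<delta> \<Longrightarrow>
        \<forall>i\<in>I. (g i (x + s *\<^sub>R (c *\<^sub>R y)) - g i x) / s < -1"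
      unfolding eventually_at_right_field by blast
    have "g i (x + s *\<^sub>R (c *\<^sub>R y)) \<le> g i x - s" if "0 < s" "s < \<delta>" "i \<in> I" for s i
      using bspec[OF \<delta>(2)[OF that(1,2)] that(3)] that(1) by (simp add: field_simps)
    with \<delta>(1) show "\<exists>y \<delta>. 0 < \<delta> \<and> (\<forall>s. 0 < s \<and> s < \<delta> \<longrightarrow> (\<forall>i\<in>I. g i (x + s *\<^sub>R y) \<le> g i x - s))"
      by blast
  next
    assume "\<exists>y \<delta>. 0 < \<delta> \<and> (\<forall>s. 0 < s \<and> s < \<delta> \<longrightarrow> (\<forall>i\<in>I. g i (x + s *\<^sub>R y) \<le> g i x - s))"
    then obtain y \<delta> where \<delta>: "\<delta> > 0"
        "\<And>s i. 0 < s \<Longrightarrow> s < \<delta> \<Longrightarrow> i \<in> I \<Longrightarrow> g i (x + s *\<^sub>R y) \<le> g i x - s"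
      by blast
    have "inner y (gradient (g i) x) < 0" if i: "i \<in> I" for i
    proof -
      have "(g i (x + s *\<^sub>R y) - g i x) / s \<le> -1" if "0 < s" "s < \<delta>" for s
        using \<delta>(2)[OF that i] that(1) by (simp add: field_simps)
      then have "\<forall>\<^sub>F s in at_right 0. (g i (x + s *\<^sub>R y) - g i x) / s \<le> -1"
        unfolding eventually_at_right_field using \<delta>(1) by blast
      then have "inner y (gradient (g i) x) \<le> -1"
        by (rule tendsto_upperbound[OF quotient[OF i]]) simp
      then show ?thesis by simp
    qed
    then show "\<exists>y. \<forall>i\<in>I. inner y (gradient (g i) x) < 0" by blast
  qed
qed

section \<open>Levels at which the constraint qualification fails\<close>

definition coord_index :: "'n::{finite,linorder} \<Rightarrow> nat" where
  "coord_index j = (SOME i. i < CARD('n) \<and> sorted_list_of_set (UNIV :: 'n set) ! i = j)"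

lemma coord_index:
  fixes j :: "'n::{finite,linorder}"
  shows "coord_index j < CARD('n)" "sorted_list_of_set UNIV ! coord_index j = j"
proof -
  have "\<exists>i. i < CARD('n) \<and> sorted_list_of_set (UNIV :: 'n set) ! i = j"
    by (metis UNIV_I finite_class.finite_UNIV in_set_conv_nth length_sorted_list_of_set set_sorted_list_of_set)
  then have "coord_index j < CARD('n) \<and> sorted_list_of_set UNIV ! coord_index j = j"
    unfolding coord_index_def by (rule someI_ex)
  then show "coord_index j < CARD('n)" "sorted_list_of_set UNIV ! coord_index j = j" by simp_all
qed

lemma coord_index_nth:
  assumes "i < CARD('n)"
  shows "coord_index (sorted_list_of_set (UNIV :: 'n::{finite,linorder} set) ! i) = i"
  using assms coord_index[of "sorted_list_of_set (UNIV :: 'n set) ! i"]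
  by (metis distinct_sorted_list_of_set length_sorted_list_of_set nth_eq_iff_index_eq)

lemma coords_eq:
  fixes x :: "real ^ 'n::{finite,linorder}"
  assumes "\<And>j. x $ j = e (coord_index j)"
  shows "coords x = map e [0..<CARD('n)]"
proof (rule nth_equalityI)
  fix i assume "i < length (coords x)"
  then have "i < CARD('n)" by (simp add: coords_def)
  then show "coords x ! i = map e [0..<CARD('n)] ! i"
    by (simp add: coords_def assms coord_index_nth)
qed (simp add: coords_def)

context o_minimal_structure
begin

lemma definable_ex_vec:
  fixes P :: "(nat \<Rightarrow> real) \<Rightarrow> real ^ 'n::{finite,linorder} \<Rightarrow> bool"
  assumes "definable (\<lambda>e. P (\<lambda>i. e (i + CARD('n))) (\<chi> j. e (coord_index j)))"
  shows "definable (\<lambda>e. \<exists>x. P e x)"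
proof -
  let ?v = "\<lambda>f. \<chi> j::'n. f (coord_index j)"
  have v: "?v (\<lambda>i. if i < CARD('n) then f i else 0) = ?v f" for f :: "nat \<Rightarrow> real"
    by (simp add: coord_index vec_eq_iff)
  have "definable (\<lambda>e. \<exists>f. P e (?v (\<lambda>i. if i < CARD('n) then f i else 0)))"
    by (rule definable_ex_fun[of "\<lambda>e f. P e (?v f)" "CARD('n)"]) (unfold v, rule assms)
  then have "definable (\<lambda>e. \<exists>f. P e (?v f))" unfolding v .
  moreover have "(\<exists>f. P e (?v f)) = (\<exists>x. P e x)" for e
  proof
    assume "\<exists>x. P e x"
    then obtain x where x: "P e x" ..
    have "?v (\<lambda>i. x $ (sorted_list_of_set UNIV ! i)) = x"
      by (simp add: vec_eq_iff coord_index)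
    with x have "P e (?v (\<lambda>i. x $ (sorted_list_of_set UNIV ! i)))" by simp
    then show "\<exists>f. P e (?v f)" by (rule exI[where P = "\<lambda>f. P e (?v f)"])
  qed blast
  ultimately show ?thesis by (simp only:)
qed

lemma definable_fun_term:
  fixes g :: "real ^ 'n::{finite,linorder} \<Rightarrow> real"
  assumes g: "definable_fun \<O> g" and T: "\<And>j. definable_term (T j)"
  shows "definable_term (\<lambda>e. g (\<chi> j. T j e))"
proof -
  let ?n = "CARD('n)" and ?l = "sorted_list_of_set (UNIV :: 'n set)"
  let ?G = "\<lambda>e. g (\<chi> j::'n. e (coord_index j))"
  have dep: "depends_below ?n ?G"
    unfolding depends_below_def by (auto simp: coord_index intro!: arg_cong[where f = g])
  have graph_dep: "depends_below (Suc ?n) (\<lambda>e. e ?n = ?G e)"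
    unfolding depends_below_def
  proof (intro allI impI)
    fix e e' :: "nat \<Rightarrow> real" assume e: "\<forall>i<Suc ?n. e i = e' i"
    have "?G e = ?G e'" by (rule depends_belowD[OF dep]) (use e in simp)
    with e show "(e ?n = ?G e) = (e' ?n = ?G e')" by simp
  qed
  have graph: "tuples (Suc ?n) (\<lambda>e. e ?n = ?G e) = {coords x @ [g x] | x. True}"
  proof (intro set_eqI iffI)
    fix zs assume "zs \<in> tuples (Suc ?n) (\<lambda>e. e ?n = ?G e)"
    then obtain e where e: "e ?n = ?G e" "zs = map e [0..<Suc ?n]" unfolding tuples_def by blast
    have "coords (\<chi> j::'n. e (coord_index j)) = map e [0..<?n]" by (rule coords_eq) simp
    then have "zs = coords (\<chi> j::'n. e (coord_index j)) @ [?G e]" using e by simp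
    then show "zs \<in> {coords x @ [g x] | x. True}" by blast
  next
    fix zs assume "zs \<in> {coords x @ [g x] | x. True}"
    then obtain x where zs: "zs = coords x @ [g x]" by blast
    define e where "e i = (if i < ?n then x $ (?l ! i) else g x)" for i
    have x: "x $ j = e (coord_index j)" for j by (simp add: e_def coord_index)
    have "zs = map e [0..<Suc ?n]" using coords_eq[of x e] x by (simp add: zs e_def)
    moreover have "(\<chi> j. e (coord_index j)) = x" by (simp add: vec_eq_iff x)
    then have "e ?n = ?G e" by (simp add: e_def)
    ultimately show "zs \<in> tuples (Suc ?n) (\<lambda>e. e ?n = ?G e)" unfolding tuples_def by blast
  qed
  have "definable (\<lambda>e. e ?n = ?G e)"
  proof (rule definableI[OF graph_dep])
    show "tuples (Suc ?n) (\<lambda>e. e ?n = ?G e) \<in> \<O> (Suc ?n)"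
      unfolding graph using g by (simp add: definable_fun_def)
  qed
  then have "definable_term ?G"
    unfolding definable_term_def using dep by blast
  then have "definable_term (\<lambda>e. ?G (\<lambda>i. T (?l ! i) e))"
    by (rule definable_term_subst[of ?G]) (rule T)
  then show ?thesis by (simp add: coord_index)
qed

text \<open>The constraints in \<open>T\<close> are kept at level \<open>0\<close>, the others move with \<open>\<alpha>\<close>. Taking \<open>T\<close> empty gives
  the sublevel sets with a common level.\<close>

lemma finite_MFCQ_failures:
  fixes g :: "'i \<Rightarrow> real ^ 'n::{finite,linorder} \<Rightarrow> real"
  assumes S: "finite S"
    and diff: "\<And>i x. i \<in> S \<Longrightarrow> g i differentiable (at x)"
    and def: "\<And>i. i \<in> S \<Longrightarrow> definable_fun \<O> (g i)"
    and T: "MFCQ (S \<inter> T) g (\<lambda>i. 0)"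
  shows "finite {\<alpha>. \<not> MFCQ S g (\<lambda>i. if i \<in> T then 0 else \<alpha>)}"
proof (rule ccontr)
  let ?\<mu> = "\<lambda>\<alpha> i. if i \<in> T then 0 else \<alpha> :: real"
  define bad where "bad I \<alpha> x \<longleftrightarrow> (\<forall>i\<in>S. g i x \<le> ?\<mu> \<alpha> i) \<and> 
    (\<forall>i\<in>S. (g i x = ?\<mu> \<alpha> i \<longrightarrow> i \<in> I) \<and> (i \<in> I \<longrightarrow> g i x = ?\<mu> \<alpha> i)) \<and>
    \<not> (\<exists>y. \<forall>i\<in>I. inner y (gradient (g i) x) < 0)" for I \<alpha> x
  assume "infinite {\<alpha>. \<not> MFCQ S g (?\<mu> \<alpha>)}"
  moreover have "{\<alpha>. \<not> MFCQ S g (?\<mu> \<alpha>)} \<subseteq> (\<Union>I\<in>Pow S. {\<alpha>. \<exists>x. bad I \<alpha> x})"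
  proof
    fix \<alpha> assume "\<alpha> \<in> {\<alpha>. \<not> MFCQ S g (?\<mu> \<alpha>)}"
    then obtain x where x: "x \<in> sublevel_set S g (?\<mu> \<alpha>)" "\<not> MFCQ_at S g (?\<mu> \<alpha>) x"
      unfolding MFCQ_def by blast
    have "bad {i \<in> S. g i x = ?\<mu> \<alpha> i} \<alpha> x"
      using x unfolding bad_def sublevel_set_def MFCQ_at_def by blast
    then show "\<alpha> \<in> (\<Union>I\<in>Pow S. {\<alpha>. \<exists>x. bad I \<alpha> x})"
      by (intro UN_I[of "{i \<in> S. g i x = ?\<mu> \<alpha> i}"] CollectI exI[of _ x]) simp_all
  qed
  ultimately have "infinite (\<Union>I\<in>Pow S. {\<alpha>. \<exists>x. bad I \<alpha> x})"
    by (metis finite_subset)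
  then obtain I where I: "I \<subseteq> S" "infinite {\<alpha>. \<exists>x. bad I \<alpha> x}"
    using S by auto
  have "finite I" using I(1) S by (rule finite_subset)
  have component: "definable_term (\<lambda>e. (\<chi> j. e (\<sigma> j)) $ j')" for \<sigma> :: "'n \<Rightarrow> nat" and j'
    by (simp add: definable_term_var)
  have level: "definable_term (\<lambda>e. ?\<mu> (e u) i)" for u i
    by (cases "i \<in> T") (simp_all add: definable_term_var definable_term_const)
  have g_term: "definable_term (\<lambda>e. g i (\<chi> j. e (\<sigma> j)))" if "i \<in> S" for i and \<sigma> :: "'n \<Rightarrow> nat"
    by (intro definable_fun_term def that definable_term_var)
  have bad_iff: "bad I \<alpha> x \<longleftrightarrow> (\<forall>i\<in>S. g i x \<le> ?\<mu> \<alpha> i) \<and>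
      (\<forall>i\<in>S. (g i x = ?\<mu> \<alpha> i \<longrightarrow> i \<in> I) \<and> (i \<in> I \<longrightarrow> g i x = ?\<mu> \<alpha> i)) \<and>
      \<not> (\<exists>y \<delta>. 0 < \<delta> \<and> (\<forall>s. 0 < s \<and> s < \<delta> \<longrightarrow>
        (\<forall>i\<in>I. g i (\<chi> j. x $ j + s * y $ j) \<le> g i x - s)))" for \<alpha> x
  proof -
    have "x + s *\<^sub>R y = (\<chi> j. x $ j + s * y $ j)" for s y by (simp add: vec_eq_iff)
    moreover have "g i differentiable (at x)" if "i \<in> I" for i
      using that diff I(1) by blast
    ultimately show ?thesis
      using strict_descent_iff[of I g x, OF \<open>finite I\<close>] unfolding bad_def by (simp only:)
  qed
  have bad_definable: "definable (\<lambda>e. bad I (e u) (\<chi> j. e (\<sigma> j)))" for u and \<sigma> :: "'n \<Rightarrow> nat"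
  proof -
    have "i \<in> S" if "i \<in> I" for i using that I(1) by blast
    then have "definable (\<lambda>e. g i (\<chi> j. (\<chi> j. e (\<sigma>1 j)) $ j + e v * (\<chi> j. e (\<sigma>2 j)) $ j)
        \<le> g i (\<chi> j. e (\<sigma>3 j)) - e w)" if "i \<in> I" for i v w and \<sigma>1 \<sigma>2 \<sigma>3 :: "'n \<Rightarrow> nat"
      using that by (intro definable_le definable_term_diff definable_fun_term def g_term
        definable_term_add definable_term_mult component definable_term_var)
    then show ?thesis
      unfolding bad_iff
      by (intro definable_conj definable_ball definable_not definable_imp definable_ex_vec
          definable_ex definable_all definable_le[OF g_term level] definable_eq[OF g_term level]
          definable_less definable_term_var definable_term_const definable_const S \<open>finite I\<close>)
  qed
  have "definable (\<lambda>e. \<exists>x. bad I (e 0) x)"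
    by (intro definable_ex_vec bad_definable)
  then obtain a b where ab: "a < b" "\<forall>\<alpha>\<in>{a<..<b}. \<exists>x. bad I \<alpha> x"
    using I(2) by (rule infinite_definable_contains_interval[of "\<lambda>\<alpha>. \<exists>x. bad I \<alpha> x"])
  let ?P = "\<lambda>e. bad I (e 0) (\<chi> j. e (Suc (coord_index j)))"
  have "depends_below (Suc CARD('n)) ?P"
    unfolding depends_below_def by (auto simp: coord_index intro!: arg_cong2[where f = "bad I"])
  moreover have "\<forall>\<alpha>\<in>{a<..<b}. \<exists>e. e 0 = \<alpha> \<and> ?P e"
  proof
    fix \<alpha> assume "\<alpha> \<in> {a<..<b}"
    then obtain x where x: "bad I \<alpha> x" using ab(2) by blast
    have "(\<chi> j. x $ (sorted_list_of_set UNIV ! coord_index j)) = x"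
      by (simp add: vec_eq_iff coord_index)
    with x show "\<exists>e. e 0 = \<alpha> \<and> ?P e"
      by (intro exI[of _ "case_nat \<alpha> (\<lambda>i. x $ (sorted_list_of_set UNIV ! i))"]) simp
  qed
  ultimately obtain a' b' X where X: "a' < b'" "\<forall>t\<in>{a'<..<b'}. X t 0 = t \<and> ?P (X t)"
      "\<forall>i. mono_on {a'<..<b'} (\<lambda>t. X t i) \<or> antimono_on {a'<..<b'} (\<lambda>t. X t i)"
    using definable_monotone_curve[of ?P "CARD('n)" a b, OF bad_definable _ ab(1)] by blast
  define \<phi> where "\<phi> t = (\<chi> j::'n. X t (Suc (coord_index j)))" for t
  have \<phi>: "bad I t (\<phi> t)" if "t \<in> {a'<..<b'}" for t
  proof -
    have "X t 0 = t" "?P (X t)" using bspec[OF X(2) that] by blast+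
    then show ?thesis by (simp only: \<phi>_def)
  qed
  have "mono_on {a'<..<b'} (\<lambda>t. \<phi> t $ j) \<or> antimono_on {a'<..<b'} (\<lambda>t. \<phi> t $ j)" for j
    using X(3) by (simp add: \<phi>_def)
  then obtain t s v where t: "t \<in> {a'<..<b'}" and s: "\<forall>k. s k \<in> {a'<..<b'} \<and> s k \<noteq> t" "s \<longlonglongrightarrow> t"
      and v: "(\<lambda>k. inverse (s k - t) *\<^sub>R (\<phi> (s k) - \<phi> t)) \<longlonglongrightarrow> v"
    by (rule monotone_curve_difference_quotient[OF X(1)])
  have s_in: "s k \<in> {a'<..<b'}" and s_neq: "s k \<noteq> t" for k using s(1) by simp_all
  have active: "g i (\<phi> r) = ?\<mu> r i" if "i \<in> I" "r \<in> {a'<..<b'}" for i r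
    using \<phi>[OF that(2)] that(1) I(1) unfolding bad_def by blast
  have v_grad: "inner v (gradient (g i) (\<phi> t)) = (if i \<in> T then 0 else 1)" if i: "i \<in> I" for i
  proof (rule gderiv_along_sequence[OF _ s_neq s(2) v])
    show "GDERIV (g i) (\<phi> t) :> gradient (g i) (\<phi> t)"
      using diff i I(1) by (intro gderiv_gradient) blast
    show "g i (\<phi> (s k)) - g i (\<phi> t) = (if i \<in> T then 0 else 1) * (s k - t)" for k
      using active[OF i s_in] active[OF i t] by simp
  qed
  have "\<phi> t \<in> sublevel_set (S \<inter> T) g (\<lambda>i. 0)"
    using \<phi>[OF t] unfolding bad_def sublevel_set_def by auto
  then obtain y where y: "\<forall>i\<in>S \<inter> T. g i (\<phi> t) = 0 \<longrightarrow> inner y (gradient (g i) (\<phi> t)) < 0"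
    using T unfolding MFCQ_def MFCQ_at_def by blast
  \<comment> \<open>large enough for the moving constraints, whose derivative along v is 1; adding multiples of v
    does not change the derivatives of the fixed ones\<close>
  define N where "N = 1 + (\<Sum>i\<in>I. \<bar>inner y (gradient (g i) (\<phi> t))\<bar>)"
  have "inner (y - N *\<^sub>R v) (gradient (g i) (\<phi> t)) < 0" if i: "i \<in> I" for i
  proof (cases "i \<in> T")
    case True
    then show ?thesis
      using y i I(1) active[OF i t] v_grad[OF i] by (auto simp: inner_diff_left)
  next
    case False
    have "\<bar>inner y (gradient (g i) (\<phi> t))\<bar> \<le> (\<Sum>i\<in>I. \<bar>inner y (gradient (g i) (\<phi> t))\<bar>)"
      using \<open>finite I\<close> by (intro member_le_sum i) auto
    then show ?thesis
      using v_grad[OF i] False by (simp add: inner_diff_left N_def)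
  qed
  then show False using \<phi>[OF t] unfolding bad_def by blast
qed

end

theorem corollary3p7:
  fixes \<O> :: "nat \<Rightarrow> real list set set"
    and g :: "nat \<Rightarrow> real ^ 'n::{finite,linorder} \<Rightarrow> real"
    and m :: nat
  assumes "o_minimal_structure \<O>"
    and "\<forall>i\<in>{1..m}. \<forall>x. g i differentiable (at x)"
    and "\<forall>i\<in>{1..m}. definable_fun \<O> (g i)"
  shows "finite {\<alpha>::real. \<not> MFCQ {1..m} g (\<lambda>i. \<alpha>)} \<and>
    (\<forall>p<m. MFCQ {1..p} g (\<lambda>i. 0) \<longrightarrow>
       finite {\<alpha>::real. \<not> MFCQ {1..m} g (\<lambda>i. if i \<le> p then 0 else \<alpha>)})"
proof -
  interpret o_minimal_structure \<O> by (rule assms(1))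
  have fin: "finite {\<alpha>. \<not> MFCQ {1..m} g (\<lambda>i. if i \<in> T then 0 else \<alpha>)}"
    if "MFCQ ({1..m} \<inter> T) g (\<lambda>i. 0)" for T
    using assms(2,3) that by (intro finite_MFCQ_failures) auto
  show ?thesis
  proof (intro conjI allI impI)
    have "MFCQ ({1..m} \<inter> {}) g (\<lambda>i. 0)" by (simp add: MFCQ_def MFCQ_at_def)
    from fin[OF this] show "finite {\<alpha>. \<not> MFCQ {1..m} g (\<lambda>i. \<alpha>)}" by simp
  next
    fix p assume p: "p < m" "MFCQ {1..p} g (\<lambda>i. 0)"
    have "{1..m} \<inter> {..p} = {1..p}" using p(1) by auto
    with p(2) have "MFCQ ({1..m} \<inter> {..p}) g (\<lambda>i. 0)" by (simp only:)
    from fin[OF this] show "finite {\<alpha>. \<not> MFCQ {1..m} g (\<lambda>i. if i \<le> p then 0 else \<alpha>)}" by simp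
  qed
qed

end
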